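(* Let $L\ge1$ be an integer. As $\big(u(1)\oplus sl(2)\big)$-modules, \[ \big(V_0^{(0)}\oplus V_1^{(1)}\oplus V_0^{(2)}\big)^{\otimes L}\;\cong\bigoplus_{\substack{0\le N\le 2L\\ 0\le M\le\lfloor N/2\rfloor}}\widetilde{Z}(L;N,M)\,V^{(N)}_{N-2M}, \] i.e. the multiplicity of the irreducible component $V^{(N)}_{N-2M}$ in the tensor product is $\widetilde{Z}(L;N,M)$.
   Context: Let $u(1)=\mathbb{C}h$ be one-dimensional, acting on tensor products additively (as a Lie algebra). For integers $N,m\ge0$, $V^{(N)}_m$ denotes the irreducible $\big(u(1)\oplus sl(2)\big)$-module of dimension $m+1$ on which $h$ acts by the scalar $N$ and $sl(2)$ acts irreducibly. For integers $x$ and $k\ge0$ let $\binom{x}{k}=\frac{x(x-1)\cdots(x-k+1)}{k!}$. For integers $0\le 2M\le N\le 2L$, \[ \widetilde{Z}(L;N,M)=\sum \binom{L}{N_r}\prod_{n\ge1}\binom{P'_n+M'_n+n}{M'_n}\binom{P_n+M_n}{M_n}, \] where the sum runs over all nonnegative integers $N_r$ and finitely supported families of nonnegative integers $(M_n)_{n\ge1},(M'_n)_{n\ge1}$ with $N=N_r+2\sum_n nM'_n$ and $M=\sum_n n(M_n+M'_n)$, and $P'_n=L-N+2\sum_{m>n}(m-n)M'_m$, $P_n=N-2M+2\sum_{m>n}(m-n)M_m$. *)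

theory Defs
  imports Complex_Main "Jordan_Normal_Form.Matrix"
begin

text \<open>A module of dimension d is given by the d x d complex matrices by which the
  basis elements of the Lie algebra act: (Hu, Hs, E, F) where Hu spans u(1) and
  (Hs, E, F) is the standard basis of sl(2) with [Hs,E]=2E, [Hs,F]=-2F, [E,F]=Hs.\<close>

type_synonym urep = "complex mat \<times> complex mat \<times> complex mat \<times> complex mat"

definition rdim :: "urep \<Rightarrow> nat" where
  "rdim V = dim_row (fst V)"

definition is_urep :: "urep \<Rightarrow> bool" where
  "is_urep V = (case V of (Hu, Hs, E, F) \<Rightarrow>
     (let d = dim_row Hu in
       Hu \<in> carrier_mat d d \<and> Hs \<in> carrier_mat d d \<and> E \<in> carrier_mat d d \<and> F \<in> carrier_mat d d \<and>
       Hu * Hs = Hs * Hu \<and> Hu * E = E * Hu \<and> Hu * F = F * Hu \<and>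
       Hs * E - E * Hs = 2 \<cdot>\<^sub>m E \<and> Hs * F - F * Hs = (-2) \<cdot>\<^sub>m F \<and> E * F - F * E = Hs))"

text \<open>The irreducible module V^(N)_m: basis v_0..v_m, Hu = N, Hs v_i = (m-2i) v_i,
  F v_i = v_(i+1) (F v_m = 0), E v_i = i(m-i+1) v_(i-1).\<close>

definition Virr :: "nat \<Rightarrow> nat \<Rightarrow> urep" where
  "Virr N m =
    (mat (m+1) (m+1) (\<lambda>(i,j). if i = j then of_nat N else 0),
     mat (m+1) (m+1) (\<lambda>(i,j). if i = j then of_int (int m - 2 * int i) else 0),
     mat (m+1) (m+1) (\<lambda>(i,j). if i + 1 = j then of_nat (j * (m + 1 - j)) else 0),
     mat (m+1) (m+1) (\<lambda>(i,j). if i = j + 1 then 1 else 0))"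

definition kron :: "complex mat \<Rightarrow> complex mat \<Rightarrow> complex mat" where
  "kron A B = mat (dim_row A * dim_row B) (dim_col A * dim_col B)
     (\<lambda>(i,j). A $$ (i div dim_row B, j div dim_col B) * B $$ (i mod dim_row B, j mod dim_col B))"

definition tens :: "urep \<Rightarrow> urep \<Rightarrow> urep" where
  "tens V W = (case V of (Hu1, Hs1, E1, F1) \<Rightarrow> case W of (Hu2, Hs2, E2, F2) \<Rightarrow>
     (let I1 = 1\<^sub>m (rdim V); I2 = 1\<^sub>m (rdim W) in
      (kron Hu1 I2 + kron I1 Hu2, kron Hs1 I2 + kron I1 Hs2,
       kron E1 I2 + kron I1 E2, kron F1 I2 + kron I1 F2)))"

definition bdiag :: "complex mat \<Rightarrow> complex mat \<Rightarrow> complex mat" where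
  "bdiag A B = four_block_mat A (0\<^sub>m (dim_row A) (dim_col B)) (0\<^sub>m (dim_row B) (dim_col A)) B"

definition dsum :: "urep \<Rightarrow> urep \<Rightarrow> urep" where
  "dsum V W = (case V of (Hu1, Hs1, E1, F1) \<Rightarrow> case W of (Hu2, Hs2, E2, F2) \<Rightarrow>
     (bdiag Hu1 Hu2, bdiag Hs1 Hs2, bdiag E1 E2, bdiag F1 F2))"

definition zero_rep :: urep where
  "zero_rep = (0\<^sub>m 0 0, 0\<^sub>m 0 0, 0\<^sub>m 0 0, 0\<^sub>m 0 0)"

definition dsum_list :: "urep list \<Rightarrow> urep" where
  "dsum_list Vs = foldr dsum Vs zero_rep"

definition one_rep :: urep where
  "one_rep = (0\<^sub>m 1 1, 0\<^sub>m 1 1, 0\<^sub>m 1 1, 0\<^sub>m 1 1)"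

primrec tpow :: "urep \<Rightarrow> nat \<Rightarrow> urep" where
  "tpow V 0 = one_rep"
| "tpow V (Suc n) = tens (tpow V n) V"

definition rep_iso :: "urep \<Rightarrow> urep \<Rightarrow> bool" where
  "rep_iso V W = (case V of (Hu1, Hs1, E1, F1) \<Rightarrow> case W of (Hu2, Hs2, E2, F2) \<Rightarrow>
     rdim V = rdim W \<and>
     (\<exists>P \<in> carrier_mat (rdim V) (rdim V). invertible_mat P \<and>
        P * Hu1 = Hu2 * P \<and> P * Hs1 = Hs2 * P \<and> P * E1 = E2 * P \<and> P * F1 = F2 * P))"

definition ibinom :: "int \<Rightarrow> nat \<Rightarrow> rat" where
  "ibinom x k = (of_int x) gchoose k"

definition supp :: "(nat \<Rightarrow> nat) \<Rightarrow> nat set" where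
  "supp f = {n. f n \<noteq> 0}"

text \<open>Index set of the sum: (N_r, (M_n)_{n\<ge>1}, (M'_n)_{n\<ge>1}), families finitely
  supported and indexed by n \<ge> 1 (value at 0 fixed to 0).\<close>

definition Zidx :: "nat \<Rightarrow> nat \<Rightarrow> (nat \<times> (nat \<Rightarrow> nat) \<times> (nat \<Rightarrow> nat)) set" where
  "Zidx N M = {(Nr, Mf, Mf'). Mf 0 = 0 \<and> Mf' 0 = 0 \<and> finite (supp Mf) \<and> finite (supp Mf') \<and>
      N = Nr + 2 * (\<Sum>n\<in>supp Mf'. n * Mf' n) \<and>
      M = (\<Sum>n\<in>supp Mf \<union> supp Mf'. n * (Mf n + Mf' n))}"

definition Pp :: "nat \<Rightarrow> nat \<Rightarrow> (nat \<Rightarrow> nat) \<Rightarrow> nat \<Rightarrow> int" where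
  "Pp L N Mf' n = int L - int N + 2 * (\<Sum>m\<in>{m\<in>supp Mf'. m > n}. int (m - n) * int (Mf' m))"

definition Pn :: "nat \<Rightarrow> nat \<Rightarrow> (nat \<Rightarrow> nat) \<Rightarrow> nat \<Rightarrow> int" where
  "Pn N M Mf n = int N - 2 * int M + 2 * (\<Sum>m\<in>{m\<in>supp Mf. m > n}. int (m - n) * int (Mf m))"

text \<open>The product over all n \<ge> 1 has only finitely many factors different from 1
  (those n with M_n \<noteq> 0 or M'_n \<noteq> 0, since x choose 0 = 1).\<close>

definition Ztilde :: "nat \<Rightarrow> nat \<Rightarrow> nat \<Rightarrow> rat" where
  "Ztilde L N M = (\<Sum>(Nr, Mf, Mf')\<in>Zidx N M.
      ibinom (int L) Nr *
      (\<Prod>n\<in>supp Mf \<union> supp Mf'.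
         ibinom (Pp L N Mf' n + int (Mf' n) + int n) (Mf' n) *
         ibinom (Pn N M Mf n + int (Mf n)) (Mf n)))"

definition Vbase :: urep where
  "Vbase = dsum_list [Virr 0 0, Virr 1 1, Virr 2 0]"

end

theory Submission
  imports Defs "HOL-Computational_Algebra.Formal_Power_Series" "HOL-Library.Multiset"
    "Jordan_Normal_Form.Determinant"
begin

text \<open>
  The multiplicity of the component with charge \<open>N\<close> and highest weight \<open>N - 2M\<close> and the number \<open>Z(L; N, M)\<close> are both
  \<open>C(L, N - M) C(L, M) - C(L, N - M + 1) C(L, M - 1)\<close>.

  For \<open>Z\<close>, fix \<open>p = \<Sum>n M'\<^sub>n\<close>; the summand then factors into two sums over partitions. Each is refined
  by the number of parts \<open>l\<close>: removing the first column of the partition gives a recursion in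
  \<open>(p, l)\<close>, solved in closed form by means of the Pfaff--Saalschuetz summation.

  For the module, tensoring a basis made of highest weight strings with the four-dimensional
  module gives again such a basis, by the explicit Clebsch--Gordan formulas. The resulting Pascal
  type recursion for the multiplicities is solved by the expression above. A basis of strings is
  the same as an isomorphism with the direct sum of the corresponding irreducible modules.
\<close>

section \<open>Two sums over partitions\<close>

text \<open>The closed form is a difference of adjacent weight space dimensions. The basis of
  \<open>Vbase\<close> describes one site as empty, up, down or doubly occupied, so \<open>L\<close>
  sites with \<open>N - M\<close> up and \<open>M\<close> down spins have
  \<open>C(L, N - M) C(L, M)\<close> states; subtracting the same product with \<open>M - 1\<close>
  for \<open>M\<close> counts the highest weight vectors of weight \<open>N - 2M\<close>. On the
  partition side, the factor split off with the first column depends on how many parts equal 1, so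
  the sum cannot be peeled column by column without recording the number of parts. The binomials
  live over the rationals because \<open>L - N\<close> may be negative. On the module side, explicit
  strings take the place of complete reducibility: spanning together with a dimension count yields
  the isomorphism.\<close>

text \<open>The number of compositions of \<open>q\<close> into \<open>j\<close> positive parts.\<close>

definition comps :: "nat \<Rightarrow> nat \<Rightarrow> nat" where
  "comps q j = (if j = 0 then (if q = 0 then 1 else 0) else if q = 0 then 0 else (q - 1) choose (j - 1))"

lemma comps_eq_0: "q < j \<Longrightarrow> comps q j = 0"
  by (auto simp: comps_def)

lemma comps_add: "l \<ge> 1 \<Longrightarrow> comps (q + l) l = (q + l - 1) choose q"
  unfolding comps_def using binomial_symmetric[of "l - 1" "q + l - 1"] by auto

text \<open>Both sides are the coefficient of \<open>t^s\<close> in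
  \<open>(1 + t/(1-t))^y = (1-t)^(-y)\<close>. The proof is Vandermonde after writing
  \<open>comps s j\<close> as \<open>C(s-1, s-j)\<close>.\<close>

lemma sum_gchoose_comps:
  fixes y :: rat
  assumes "s \<le> n"
  shows "(\<Sum>j\<le>n. (y gchoose j) * of_nat (comps s j)) = (y + of_nat s - 1) gchoose s"
proof (cases "s = 0")
  case True
  have "(\<Sum>j\<le>n. (y gchoose j) * of_nat (comps s j)) = (\<Sum>j\<le>n. if j = 0 then 1 else 0)"
    by (rule sum.cong) (auto simp: comps_def True)
  then show ?thesis using True by simp
next
  case False
  have "(\<Sum>j\<le>n. (y gchoose j) * of_nat (comps s j)) = (\<Sum>j\<in>{0..s}. (y gchoose j) * of_nat (comps s j))"
    using assms by (intro sum.mono_neutral_right) (auto simp: comps_eq_0)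
  also have "\<dots> = (\<Sum>j\<in>{0..s}. (y gchoose j) * (of_nat (s - 1) gchoose (s - j)))"
  proof (rule sum.cong)
    fix j assume j: "j \<in> {0..s}"
    have "comps s j = (s - 1) choose (s - j)"
    proof (cases "j = 0")
      case True then show ?thesis using False by (simp add: comps_def)
    next
      case j0: False
      then have "(s - 1) choose (j - 1) = (s - 1) choose (s - 1 - (j - 1))"
        using j by (intro binomial_symmetric) auto
      moreover have "s - 1 - (j - 1) = s - j" using j0 by auto
      ultimately show ?thesis using False j0 by (simp add: comps_def)
    qed
    then show "(y gchoose j) * of_nat (comps s j) = (y gchoose j) * (of_nat (s - 1) gchoose (s - j))"
      by (simp add: binomial_gbinomial)
  qed simp
  also have "\<dots> = (y + of_nat (s - 1)) gchoose s"
    by (rule gbinomial_Vandermonde)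
  also have "y + of_nat (s - 1) = y + of_nat s - 1" using False by (simp add: of_nat_diff)
  finally show ?thesis .
qed

text \<open>Double count of the refinements of a composition of \<open>q\<close> into
  \<open>j\<close> parts to one into \<open>s\<close> parts: either add \<open>s - j\<close> cuts at
  the \<open>q - j\<close> free places, or group the \<open>s\<close> finer parts into
  \<open>j\<close> consecutive blocks.\<close>

lemma comps_trinomial:
  assumes "j \<le> q" "j \<le> s"
  shows "((q - j) choose (s - j)) * comps q j = comps q s * comps s j"
proof (cases "j = 0")
  case True
  then show ?thesis by (auto simp: comps_def)
next
  case False
  show ?thesis
  proof (cases "s \<le> q")
    case True
    have "((q - 1) choose (s - 1)) * ((s - 1) choose (j - 1)) = 
      ((q - 1) choose (j - 1)) * ((q - 1 - (j - 1)) choose (s - 1 - (j - 1)))"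
      by (rule choose_mult) (use True assms in auto)
    moreover have "q - 1 - (j - 1) = q - j" "s - 1 - (j - 1) = s - j" using False by auto
    ultimately show ?thesis using False assms by (simp add: comps_def mult.commute)
  qed (use assms in \<open>auto simp: comps_eq_0\<close>)
qed

text \<open>Vandermonde for the upper argument \<open>(q - j) + (x + l)\<close>, followed by
  \<open>comps_trinomial\<close>, leaves \<open>j\<close> only in \<open>comps s j\<close>. This
  decouples the sum over \<open>j\<close> in the summation below.\<close>

lemma gchoose_mult_comps:
  fixes x :: rat
  assumes "j \<le> l"
  shows "((x + of_nat (q + l) - of_nat j) gchoose (l - j)) * of_nat (comps q j)
    = (\<Sum>s\<le>l. ((x + of_nat l) gchoose (l - s)) * of_nat (comps q s) * of_nat (comps s j))"
proof (cases "j \<le> q")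
  case False
  then have "comps q s * comps s j = 0" for s
    by (cases "s < j") (auto simp: comps_eq_0)
  then have z: "comps q s = 0 \<or> comps s j = 0" for s by simp
  have "((x + of_nat l) gchoose (l - s)) * of_nat (comps q s) * of_nat (comps s j) = 0" for s
    using z[of s] by auto
  then have "(\<Sum>s\<le>l. ((x + of_nat l) gchoose (l - s)) * of_nat (comps q s) * of_nat (comps s j)) = 0"
    by (simp only: sum.neutral_const)
  then show ?thesis using False by (simp add: comps_eq_0)
next
  case True
  have "x + of_nat (q + l) - of_nat j = of_nat (q - j) + (x + of_nat l)"
    using True by (simp add: of_nat_diff)
  then have "((x + of_nat (q + l) - of_nat j) gchoose (l - j))
     = (\<Sum>i\<in>{0..l-j}. (of_nat (q - j) gchoose i) * ((x + of_nat l) gchoose (l - j - i)))"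
    by (simp only: gbinomial_Vandermonde)
  also have "\<dots> = (\<Sum>s\<in>{j..l}. (of_nat (q - j) gchoose (s - j)) * ((x + of_nat l) gchoose (l - s)))"
    by (rule sum.reindex_bij_witness[of _ "\<lambda>s. s - j" "\<lambda>i. i + j"]) (use assms in \<open>auto simp: add.commute\<close>)
  finally have "((x + of_nat (q + l) - of_nat j) gchoose (l - j)) * of_nat (comps q j)
     = (\<Sum>s\<in>{j..l}. ((x + of_nat l) gchoose (l - s)) * (of_nat (((q - j) choose (s - j)) * comps q j)))"
    by (simp add: sum_distrib_right sum_distrib_left binomial_gbinomial mult_ac)
  also have "\<dots> = (\<Sum>s\<in>{j..l}. ((x + of_nat l) gchoose (l - s)) * of_nat (comps q s) * of_nat (comps s j))"
    by (rule sum.cong) (auto simp: comps_trinomial True simp del: of_nat_mult, simp)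
  also have "\<dots> = (\<Sum>s\<le>l. ((x + of_nat l) gchoose (l - s)) * of_nat (comps q s) * of_nat (comps s j))"
    by (rule sum.mono_neutral_left) (auto simp: comps_eq_0)
  finally show ?thesis .
qed

text \<open>A form of the Pfaff--Saalschuetz summation.\<close>

lemma Saalschuetz_comps:
  fixes x :: rat
  assumes "l \<ge> 1"
  shows "(\<Sum>j\<le>l. ((x + of_nat (q + l) - of_nat j) gchoose (l - j)) * (((x + 1) gchoose j) * of_nat (comps q j)))
    = ((x + of_nat l) gchoose l) * of_nat (comps (q + l) l)"
proof -
  have "(\<Sum>j\<le>l. ((x + of_nat (q + l) - of_nat j) gchoose (l - j)) * (((x + 1) gchoose j) * of_nat (comps q j)))
    = (\<Sum>j\<le>l. ((x + 1) gchoose j) * (((x + of_nat (q + l) - of_nat j) gchoose (l - j)) * of_nat (comps q j)))"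
    by (simp add: mult_ac)
  also have "\<dots> = (\<Sum>j\<le>l. \<Sum>s\<le>l. ((x + 1) gchoose j) * (((x + of_nat l) gchoose (l - s)) * of_nat (comps q s) * of_nat (comps s j)))"
    by (intro sum.cong refl, subst gchoose_mult_comps) (simp_all add: sum_distrib_left)
  \<comment> \<open>Once the sums are exchanged, both are evaluated by
    \<open>sum_gchoose_comps\<close>: the inner one with \<open>y = x + 1\<close>, and, after
    trinomial revision has pulled out a factor free of \<open>s\<close>, the outer one with
    \<open>y = l\<close>.\<close>
  also have "\<dots> = (\<Sum>s\<le>l. \<Sum>j\<le>l. ((x + 1) gchoose j) * (((x + of_nat l) gchoose (l - s)) * of_nat (comps q s) * of_nat (comps s j)))"
    by (rule sum.swap)
  also have "\<dots> = (\<Sum>s\<le>l. (((x + of_nat l) gchoose (l - s)) * of_nat (comps q s)) * (\<Sum>j\<le>l. ((x + 1) gchoose j) * of_nat (comps s j)))"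
    by (simp add: sum_distrib_left mult_ac)
  also have "\<dots> = (\<Sum>s\<le>l. ((x + of_nat l) gchoose l) * ((of_nat l gchoose s) * of_nat (comps q s)))"
  proof (rule sum.cong)
    fix s assume "s \<in> {..l}"
    then have s: "s \<le> l" by simp
    have "((x + of_nat l) gchoose l) * (of_nat l gchoose (l - s)) =
      ((x + of_nat l) gchoose (l - s)) * ((x + of_nat l - of_nat (l - s)) gchoose (l - (l - s)))"
      by (rule gbinomial_trinomial_revision) simp
    moreover have "x + of_nat l - of_nat (l - s) = x + of_nat s" "l - (l - s) = s"
      using s by (auto simp: of_nat_diff)
    moreover have "(of_nat l gchoose (l - s)) = (of_nat l gchoose s :: rat)"
      using s by (metis binomial_gbinomial binomial_symmetric)
    moreover have "(\<Sum>j\<le>l. ((x + 1) gchoose j) * of_nat (comps s j)) = (x + of_nat s) gchoose s"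
      using sum_gchoose_comps[OF s, of "x + 1"] by simp
    ultimately show "(((x + of_nat l) gchoose (l - s)) * of_nat (comps q s)) * (\<Sum>j\<le>l. ((x + 1) gchoose j) * of_nat (comps s j))
      = ((x + of_nat l) gchoose l) * ((of_nat l gchoose s) * of_nat (comps q s))"
      by (simp add: mult_ac)
  qed simp
  also have "\<dots> = ((x + of_nat l) gchoose l) * (\<Sum>s\<le>l. (of_nat l gchoose s) * of_nat (comps q s))"
    by (simp add: sum_distrib_left)
  also have "(\<Sum>s\<le>l. (of_nat l gchoose s) * of_nat (comps q s)) = (\<Sum>s\<le>max l q. ((of_nat l gchoose s) * of_nat (comps q s) :: rat))"
    by (rule sum.mono_neutral_left) (auto simp flip: binomial_gbinomial)
  also have "\<dots> = (of_nat l + of_nat q - 1) gchoose q"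
    by (rule sum_gchoose_comps) simp
  also have "of_nat l + of_nat q - 1 = (of_nat (q + l - 1) :: rat)"
    using assms by (simp add: of_nat_diff)
  finally show ?thesis using assms by (simp add: comps_add binomial_gbinomial)
qed

section \<open>Partitions by number of parts, and the recursion on columns\<close>

text \<open>Partitions of \<open>p\<close> into \<open>l\<close> parts in multiplicity notation:
  \<open>f n\<close> is the number of parts equal to \<open>n\<close>. Fixing \<open>f 0 = 0\<close>
  makes the encoding unique.\<close>

definition configs :: "nat \<Rightarrow> nat \<Rightarrow> (nat \<Rightarrow> nat) set" where
  "configs p l = {f. f 0 = 0 \<and> finite (supp f) \<and> (\<Sum>n\<in>supp f. n * f n) = p \<and> (\<Sum>n\<in>supp f. f n) = l}"

text \<open>With \<open>a = N - 2M\<close>, \<open>b = 0\<close> this is the product over the \<open>M\<^sub>n\<close>;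
  with \<open>a = L - N\<close>, \<open>b = 1\<close> it is the product over the \<open>M'\<^sub>n\<close>.\<close>

definition weight :: "rat \<Rightarrow> rat \<Rightarrow> (nat \<Rightarrow> nat) \<Rightarrow> rat" where
  "weight a b f = (\<Prod>n\<in>supp f.
     (a + b * of_nat n + 2 * (\<Sum>m\<in>{m\<in>supp f. m > n}. of_nat (m - n) * of_nat (f m)) + of_nat (f n)) gchoose f n)"

text \<open>Adds a first column to the Young diagram of \<open>f\<close>: every part grows by one
  and \<open>k\<close> parts equal to 1 appear. The value \<open>f 0\<close> is discarded.\<close>

definition prepend :: "nat \<Rightarrow> (nat \<Rightarrow> nat) \<Rightarrow> nat \<Rightarrow> nat" where
  "prepend k f n = (case n of 0 \<Rightarrow> 0 | Suc 0 \<Rightarrow> k | Suc (Suc r) \<Rightarrow> f (Suc r))"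

lemma prepend_simps [simp]:
  "prepend k f 0 = 0" "prepend k f (Suc 0) = k" "n \<noteq> 0 \<Longrightarrow> prepend k f (Suc n) = f n"
  by (auto simp: prepend_def split: nat.splits)

lemma supp_prepend:
  assumes "f 0 = 0"
  shows "supp (prepend k f) = (if k = 0 then {} else {Suc 0}) \<union> Suc ` supp f"
proof -
  have "n \<in> supp (prepend k f) \<longleftrightarrow> n \<in> (if k = 0 then {} else {Suc 0}) \<union> Suc ` supp f" for n
    using assms by (auto simp: supp_def prepend_def image_iff split: nat.splits)
  then show ?thesis by blast
qed

lemma finite_supp_prepend:
  assumes "f 0 = 0" shows "finite (supp (prepend k f)) = finite (supp f)"
  by (simp add: supp_prepend assms finite_image_iff)

lemma sum_supp_prepend:
  assumes "f 0 = 0" "finite (supp f)" "k = 0 \<Longrightarrow> h (Suc 0) = (0::'a::comm_monoid_add)"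
  shows "(\<Sum>n\<in>supp (prepend k f). h n) = h (Suc 0) + (\<Sum>n\<in>supp f. h (Suc n))"
proof -
  have "0 \<notin> supp f" using assms by (simp add: supp_def)
  then have ni: "Suc 0 \<notin> Suc ` supp f" by auto
  have "(\<Sum>n\<in>supp (prepend k f). h n) = (\<Sum>n\<in>insert (Suc 0) (Suc ` supp f). h n)"
    using assms by (intro sum.mono_neutral_left) (auto simp: supp_prepend split: if_splits)
  also have "\<dots> = h (Suc 0) + (\<Sum>n\<in>Suc ` supp f. h n)" using ni assms by simp
  finally show ?thesis by (simp add: sum.reindex)
qed

lemma prod_supp_prepend:
  assumes "f 0 = 0" "finite (supp f)" "k = 0 \<Longrightarrow> h (Suc 0) = (1::'a::comm_monoid_mult)"
  shows "(\<Prod>n\<in>supp (prepend k f). h n) = h (Suc 0) * (\<Prod>n\<in>supp f. h (Suc n))"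
proof -
  have "0 \<notin> supp f" using assms by (simp add: supp_def)
  then have ni: "Suc 0 \<notin> Suc ` supp f" by auto
  have "(\<Prod>n\<in>supp (prepend k f). h n) = (\<Prod>n\<in>insert (Suc 0) (Suc ` supp f). h n)"
    using assms by (intro prod.mono_neutral_left) (auto simp: supp_prepend split: if_splits)
  also have "\<dots> = h (Suc 0) * (\<Prod>n\<in>Suc ` supp f. h n)" using ni assms by simp
  finally show ?thesis by (simp add: prod.reindex)
qed

text \<open>The differences \<open>m - n\<close> are invariant under the shift of parts, and
  \<open>a + b (n + 1) = (a + b) + b n\<close>, so the factors at \<open>n + 1\<close> are those of
  \<open>f\<close> at \<open>n\<close> with \<open>a + b\<close> for \<open>a\<close>. In the factor
  at 1 the inner sum is the size of \<open>f\<close>.\<close>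

lemma weight_prepend:
  assumes f: "f 0 = 0" "finite (supp f)"
  shows "weight a b (prepend k f) = 
    ((a + b + 2 * of_nat (\<Sum>n\<in>supp f. n * f n) + of_nat k) gchoose k) * weight (a + b) b f"
proof -
  let ?g = "prepend k f"
  define S where "S n = (\<Sum>m\<in>{m\<in>supp ?g. m > n}. of_nat (m - n) * of_nat (?g m) :: rat)" for n
  have S: "S (Suc n) = (\<Sum>m\<in>{m\<in>supp f. m > n}. of_nat (m - n) * of_nat (f m))" for n
  proof -
    have "{m\<in>supp ?g. m > Suc n} = Suc ` {m\<in>supp f. m > n}"
      using f by (auto simp: supp_prepend)
    then have "S (Suc n) = (\<Sum>m\<in>{m\<in>supp f. m > n}. of_nat (m - n) * of_nat (?g (Suc m)))"
      by (simp add: S_def sum.reindex)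
    then show ?thesis by (auto intro!: sum.cong)
  qed
  have "{m \<in> supp f. 0 < m} = supp f" using f by (auto simp: supp_def intro: Nat.gr0I)
  then have S1: "S (Suc 0) = of_nat (\<Sum>n\<in>supp f. n * f n)"
    by (simp add: S)
  have "weight a b ?g = (\<Prod>n\<in>supp ?g. (a + b * of_nat n + 2 * S n + of_nat (?g n)) gchoose ?g n)"
    by (simp add: weight_def S_def)
  also have "\<dots> = ((a + b * of_nat (Suc 0) + 2 * S (Suc 0) + of_nat (?g (Suc 0))) gchoose ?g (Suc 0)) *
     (\<Prod>n\<in>supp f. (a + b * of_nat (Suc n) + 2 * S (Suc n) + of_nat (?g (Suc n))) gchoose ?g (Suc n))"
    using f by (intro prod_supp_prepend) auto
  also have "(\<Prod>n\<in>supp f. (a + b * of_nat (Suc n) + 2 * S (Suc n) + of_nat (?g (Suc n))) gchoose ?g (Suc n)) = weight (a + b) b f"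
    unfolding weight_def S
  proof (rule prod.cong)
    fix n assume "n \<in> supp f"
    then have "n \<noteq> 0" using f by (auto simp: supp_def intro: Nat.gr0I)
    then have "?g (Suc n) = f n" by simp
    then show "((a + b * of_nat (Suc n) + 2 * (\<Sum>m\<in>{m\<in>supp f. m > n}. of_nat (m - n) * of_nat (f m)) + of_nat (?g (Suc n))) gchoose ?g (Suc n))
     = ((a + b + b * of_nat n + 2 * (\<Sum>m\<in>{m\<in>supp f. m > n}. of_nat (m - n) * of_nat (f m)) + of_nat (f n)) gchoose f n)"
      by (simp add: algebra_simps)
  qed simp
  finally show ?thesis by (simp add: S1)
qed

lemma configs_0: "configs p 0 = (if p = 0 then {\<lambda>_. 0} else {})"
proof -
  have "f = (\<lambda>_. 0) \<and> p = 0" if "f \<in> configs p 0" for f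
  proof -
    have "\<forall>n\<in>supp f. f n = 0" using that by (auto simp: configs_def)
    then have "supp f = {}" by (auto simp: supp_def)
    then show ?thesis using that by (auto simp: configs_def supp_def)
  qed
  then have "configs p 0 \<subseteq> (if p = 0 then {\<lambda>_. 0} else {})" by fastforce
  moreover have "(\<lambda>_. 0) \<in> configs 0 0" by (simp add: configs_def supp_def)
  ultimately show ?thesis by (cases "p = 0") auto
qed

lemma configs_empty: 
  assumes "p < l" shows "configs p l = {}"
proof -
  have False if "f \<in> configs p l" for f
  proof -
    have f0: "f 0 = 0" using that by (auto simp: configs_def)
    have "(\<Sum>n\<in>supp f. f n) \<le> (\<Sum>n\<in>supp f. n * f n)"
    proof (rule sum_mono)
      fix n assume "n \<in> supp f"
      then have "n \<noteq> 0" using f0 by (auto simp: supp_def intro: Nat.gr0I)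
      then show "f n \<le> n * f n" by simp
    qed
    then show False using that assms by (auto simp: configs_def)
  qed
  then show ?thesis by auto
qed

lemma inj_on_prepend: "inj_on (prepend k) {f. f 0 = 0}"
proof (rule inj_onI, rule ext)
  fix f g :: "nat \<Rightarrow> nat" and n assume *: "f \<in> {f. f 0 = 0}" "g \<in> {f. f 0 = 0}" "prepend k f = prepend k g"
  show "f n = g n"
    using *(1,2) fun_cong[OF *(3), of "Suc n"] by (cases "n = 0") auto
qed

text \<open>Removing the first column of a partition of \<open>q + l\<close> into \<open>l\<close>
  parts, \<open>l - j\<close> of them equal to 1, leaves a partition of \<open>q\<close> into
  \<open>j\<close> parts.\<close>

lemma configs_rec: "configs (q + l) l = (\<Union>j\<le>l. prepend (l - j) ` configs q j)"
proof (intro equalityI subsetI)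
  fix g assume g: "g \<in> configs (q + l) l"
  define f where "f n = (if n = 0 then 0 else g (Suc n))" for n
  define k where "k = g (Suc 0)"
  have g_eq: "g = prepend k f"
    using g by (auto simp: fun_eq_iff prepend_def f_def k_def configs_def split: nat.splits)
  have f0: "f 0 = 0" by (simp add: f_def)
  have fin: "finite (supp f)" using g finite_supp_prepend[of f k, OF f0] by (auto simp: configs_def g_eq)
  have nz: "n \<noteq> 0" if "n \<in> supp f" for n using that f0 by (auto simp: supp_def intro: Nat.gr0I)
  have 1: "l = k + (\<Sum>n\<in>supp f. f n)"
    using g sum_supp_prepend[OF f0 fin, of k "prepend k f"] nz by (auto simp: configs_def g_eq)
  have "q + l = k + (\<Sum>n\<in>supp f. Suc n * f n)"
    using g sum_supp_prepend[OF f0 fin, of k "\<lambda>n. n * prepend k f n"] nz by (auto simp: configs_def g_eq)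
  then have "q = (\<Sum>n\<in>supp f. n * f n)" using 1 by (simp add: sum.distrib)
  then show "g \<in> (\<Union>j\<le>l. prepend (l - j) ` configs q j)"
    using 1 f0 fin by (auto simp: g_eq configs_def intro!: bexI[of _ "l - k"])
next
  fix g assume "g \<in> (\<Union>j\<le>l. prepend (l - j) ` configs q j)"
  then obtain j f where j: "j \<le> l" and f: "f \<in> configs q j" and g: "g = prepend (l - j) f" by auto
  have f0: "f 0 = 0" and fin: "finite (supp f)" using f by (auto simp: configs_def)
  have nz: "n \<noteq> 0" if "n \<in> supp f" for n using that f0 by (auto simp: supp_def intro: Nat.gr0I)
  show "g \<in> configs (q + l) l"
    using f j sum_supp_prepend[OF f0 fin, of "l - j" g] nz
       sum_supp_prepend[OF f0 fin, of "l - j" "\<lambda>n. n * g n"]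
    by (auto simp: configs_def g finite_supp_prepend sum.distrib)
qed

lemma finite_configs: "finite (configs p l)"
proof (induction p arbitrary: l rule: less_induct)
  case (less p)
  consider "l = 0" | "p < l" | "l > 0" "p = (p - l) + l" by linarith
  then show ?case
  proof cases
    case 3
    then have "p - l < p" by linarith
    then have "finite (\<Union>j\<le>l. prepend (l - j) ` configs (p - l) j)" using less by blast
    then show ?thesis using 3(2) configs_rec by metis
  qed (auto simp: configs_0 configs_empty)
qed

lemma sum_weight_rec:
  "(\<Sum>f\<in>configs (q + l) l. weight a b f) =
   (\<Sum>j\<le>l. ((a + b + 2 * of_nat q + of_nat (l - j)) gchoose (l - j)) * (\<Sum>f\<in>configs q j. weight (a + b) b f))"
proof -
  have "(\<Sum>f\<in>configs (q + l) l. weight a b f) = (\<Sum>j\<le>l. \<Sum>f\<in>prepend (l - j) ` configs q j. weight a b f)"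
    unfolding configs_rec
  proof (rule sum.UNION_disjoint)
    show "\<forall>i\<in>{..l}. \<forall>j\<in>{..l}. i \<noteq> j \<longrightarrow> prepend (l - i) ` configs q i \<inter> prepend (l - j) ` configs q j = {}"
    proof (intro ballI impI, rule ccontr)
      fix i j assume ij: "i \<in> {..l}" "j \<in> {..l}" "i \<noteq> j"
      assume "prepend (l - i) ` configs q i \<inter> prepend (l - j) ` configs q j \<noteq> {}"
      then obtain f g where "prepend (l - i) f = prepend (l - j) g" by blast
      from fun_cong[OF this, of "Suc 0"] show False using ij by auto
    qed
  qed (auto simp: finite_configs)
  also have "\<dots> = (\<Sum>j\<le>l. \<Sum>f\<in>configs q j. weight a b (prepend (l - j) f))"
  proof (rule sum.cong)
    fix j
    have "inj_on (prepend (l - j)) (configs q j)"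
      by (rule inj_on_subset[OF inj_on_prepend]) (auto simp: configs_def)
    then show "(\<Sum>f\<in>prepend (l - j) ` configs q j. weight a b f) = (\<Sum>f\<in>configs q j. weight a b (prepend (l - j) f))"
      by (simp add: sum.reindex)
  qed simp
  also have "\<dots> = (\<Sum>j\<le>l. \<Sum>f\<in>configs q j. ((a + b + 2 * of_nat q + of_nat (l - j)) gchoose (l - j)) * weight (a + b) b f)"
    by (intro sum.cong refl, subst weight_prepend) (auto simp: configs_def)
  finally show ?thesis by (simp add: sum_distrib_left)
qed

lemma weight_0 [simp]: "weight a b (\<lambda>_. 0) = 1"
  by (simp add: weight_def supp_def)

text \<open>The induction step is \<open>Saalschuetz_comps\<close> with
  \<open>x = a + 1 + q\<close>. The parameter \<open>a\<close> is generalized because each removed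
  column raises it by \<open>b = 1\<close>.\<close>

lemma sum_weight_1:
  "(\<Sum>f\<in>configs p l. weight a 1 f) = ((a + of_nat p + 1) gchoose l) * of_nat (comps p l)"
proof (induction p arbitrary: a l rule: less_induct)
  case (less p)
  consider "l = 0" | "p < l" | "l > 0" "p = (p - l) + l" by linarith
  then show ?case
  proof cases
    case 3
    define q where "q = p - l"
    have q: "q < p" "p = q + l" using 3 by (auto simp: q_def)
    have "(\<Sum>f\<in>configs p l. weight a 1 f) = 
      (\<Sum>j\<le>l. ((a + 1 + 2 * of_nat q + of_nat (l - j)) gchoose (l - j)) * (((a + 1 + of_nat q + 1) gchoose j) * of_nat (comps q j)))"
      unfolding q(2) sum_weight_rec less.IH[OF q(1)] ..
    also have "\<dots> = (\<Sum>j\<le>l. (((a + 1 + of_nat q) + of_nat (q + l) - of_nat j) gchoose (l - j)) * (((a + 1 + of_nat q + 1) gchoose j) * of_nat (comps q j)))"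
      by (rule sum.cong) (auto simp: of_nat_diff algebra_simps)
    also have "\<dots> = ((a + 1 + of_nat q + of_nat l) gchoose l) * of_nat (comps (q + l) l)"
      by (rule Saalschuetz_comps) (use 3 in simp)
    finally show ?thesis by (simp add: q(2) algebra_simps)
  qed (auto simp: configs_0 configs_empty comps_def)
qed

text \<open>For \<open>a = 0\<close> and \<open>p > 0\<close> these are the Narayana numbers. With
  \<open>b = 0\<close> the parameter \<open>a\<close> is unchanged and the prefactor at
  \<open>q\<close> is free of \<open>j\<close>, so \<open>Saalschuetz_comps\<close> applies with
  \<open>x = a + q\<close>. The assumption on \<open>a\<close> keeps the denominators
  nonzero.\<close>

lemma sum_weight_0:
  assumes "a \<ge> 0"
  shows "(\<Sum>f\<in>configs p l. weight a 0 f) = (a + 1) / (a + of_nat p + 1) * ((a + of_nat p + 1) gchoose l) * of_nat (comps p l)"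
proof (induction p arbitrary: l rule: less_induct)
  case (less p)
  have nz: "a + of_nat k + 1 \<noteq> 0" for k
    using assms by (metis add.commute add_nonneg_eq_0_iff add_nonneg_nonneg of_nat_0_le_iff zero_le_one zero_neq_one)
  consider "l = 0" | "p < l" | "l > 0" "p = (p - l) + l" by linarith
  then show ?case
  proof cases
    case 3
    define q where "q = p - l"
    have q: "q < p" "p = q + l" using 3 by (auto simp: q_def)
    have "(\<Sum>f\<in>configs p l. weight a 0 f) = 
      (\<Sum>j\<le>l. ((a + 0 + 2 * of_nat q + of_nat (l - j)) gchoose (l - j)) * ((a + 1) / (a + of_nat q + 1) * ((a + of_nat q + 1) gchoose j) * of_nat (comps q j)))"
      unfolding q(2) sum_weight_rec by (simp add: less.IH[OF q(1)])
    also have "\<dots> = (a + 1) / (a + of_nat q + 1) * (\<Sum>j\<le>l. (((a + of_nat q) + of_nat (q + l) - of_nat j) gchoose (l - j)) * (((a + of_nat q + 1) gchoose j) * of_nat (comps q j)))"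
      unfolding sum_distrib_left by (rule sum.cong) (auto simp: of_nat_diff algebra_simps)
    also have "\<dots> = (a + 1) / (a + of_nat q + 1) * (((a + of_nat q + of_nat l) gchoose l) * of_nat (comps (q + l) l))"
      by (subst Saalschuetz_comps) (use 3 in simp_all)
    \<comment> \<open>Absorption, with \<open>a + p + 1 - l = a + q + 1\<close>: this converts the
      prefactor for \<open>q\<close> into the one for \<open>p\<close>.\<close>
    also have "((a + of_nat q + of_nat l) gchoose l) = (a + of_nat q + 1) / (a + of_nat p + 1) * ((a + of_nat p + 1) gchoose l)"
      using gbinomial_absorb_comp[of "a + of_nat p + 1" l] nz[of p] 
      by (simp add: q(2) field_simps)
    finally show ?thesis using nz[of q] by (simp add: q(2))
  qed (use nz in \<open>auto simp: configs_0 configs_empty comps_def\<close>, use nz[of 0] in simp)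
qed

section \<open>The numbers \<open>Z(L; N, M)\<close>\<close>

definition families :: "nat \<Rightarrow> (nat \<Rightarrow> nat) set" where
  "families p = {f. f 0 = 0 \<and> finite (supp f) \<and> (\<Sum>n\<in>supp f. n * f n) = p}"

lemma families_eq: "families p = (\<Union>l\<le>p. configs p l)"
proof (intro equalityI subsetI)
  fix f assume f: "f \<in> families p"
  define l where "l = (\<Sum>n\<in>supp f. f n)"
  have fl: "f \<in> configs p l" using f by (simp add: families_def configs_def l_def)
  moreover have "l \<le> p" using configs_empty[of p l] fl by (cases "p < l") auto
  ultimately show "f \<in> (\<Union>l\<le>p. configs p l)" by blast
qed (auto simp: families_def configs_def)

lemma finite_families: "finite (families p)"
  by (simp add: families_eq finite_configs)

lemma sum_families: "(\<Sum>f\<in>families p. h f) = (\<Sum>l\<le>p. \<Sum>f\<in>configs p l. h f)"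
  unfolding families_eq by (rule sum.UNION_disjoint) (auto simp: finite_configs, auto simp: configs_def)

lemma sum_families_weight_1: "(\<Sum>f\<in>families p. weight a 1 f) = (a + 2 * of_nat p) gchoose p"
  using sum_gchoose_comps[of p p "a + of_nat p + 1"]
  by (simp add: sum_families sum_weight_1 algebra_simps)

lemma binomial_Suc_absorb: "Suc k * (n choose Suc k) = (n - k) * (n choose k)"
  by (metis binomial_absorb_comp binomial_absorption)

text \<open>A ballot number, the multiplicity of \<open>V_n\<close> in the tensor power
  \<open>n + 2p\<close> of the two-dimensional \<open>sl(2)\<close>-module. The quotient form
  becomes a difference through \<open>n + 1 = (n + p + 1) - p\<close> and absorption.\<close>

lemma sum_families_weight_0:
  "(\<Sum>f\<in>families p. weight (of_nat n) 0 f) = 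
    of_nat ((n + 2 * p) choose p) - (if p = 0 then 0 else of_nat ((n + 2 * p) choose (p - 1)))"
proof -
  have "(\<Sum>f\<in>families p. weight (of_nat n) 0 f) =
    (of_nat n + 1) / (of_nat n + of_nat p + 1) * (\<Sum>l\<le>p. ((of_nat n + of_nat p + 1) gchoose l) * of_nat (comps p l))"
    by (simp add: sum_families sum_weight_0 sum_distrib_left mult.assoc)
  also have "\<dots> = of_nat (n + 1) / of_nat (n + p + 1) * of_nat ((n + 2 * p) choose p)"
    by (subst sum_gchoose_comps) (simp_all add: binomial_gbinomial algebra_simps)
  also have "\<dots> = of_nat ((n + 2 * p) choose p) - (if p = 0 then 0 else of_nat ((n + 2 * p) choose (p - 1)))"
  proof (cases "p = 0")
    case False
    then have "Suc (p - 1) = p" "(n + 2 * p) - (p - 1) = n + p + 1" by auto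
    then have "p * ((n + 2 * p) choose p) = (n + p + 1) * ((n + 2 * p) choose (p - 1))"
      using binomial_Suc_absorb[of "p - 1" "n + 2 * p"] by (simp only:)
    then have *: "(of_nat p :: rat) * of_nat ((n + 2 * p) choose p) = of_nat (n + p + 1) * of_nat ((n + 2 * p) choose (p - 1))"
      by (metis of_nat_mult)
    have nz: "(of_nat (n + p + 1) :: rat) \<noteq> 0" by (metis Suc_eq_plus1 of_nat_neq_0)
    have "of_nat (n + 1) / of_nat (n + p + 1) * (of_nat ((n + 2 * p) choose p) :: rat)
      = (of_nat (n + p + 1) - of_nat p) * of_nat ((n + 2 * p) choose p) / of_nat (n + p + 1)" by simp
    also have "\<dots> = of_nat ((n + 2 * p) choose p) - of_nat ((n + 2 * p) choose (p - 1))"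
      unfolding left_diff_distrib * using nz by (simp add: diff_divide_distrib del: of_nat_add)
    finally show ?thesis using False by (simp only: if_False)
  qed (simp add: add.commute)
  finally show ?thesis .
qed

section \<open>Counting occupations of sites and the closed form\<close>

lemma choose_choose: "k \<le> m \<Longrightarrow> (n choose m) * (m choose k) = (n choose k) * ((n - k) choose (m - k))"
  by (cases "m \<le> n"; cases "k \<le> n") (auto simp: choose_mult binomial_eq_0 not_le)

text \<open>Two disjoint subsets of sizes \<open>i\<close> and \<open>p\<close> can be picked in
  either order.\<close>

lemma choose_choose_commute: "(n choose i) * ((n - i) choose p) = (n choose p) * ((n - p) choose i)"
  using choose_choose[of i "i + p" n] choose_choose[of p "i + p" n] binomial_symmetric[of i "i + p"]
  by simp

text \<open>Choose the singly occupied sites, the doubly occupied ones and the down spins; or choose the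
  up and the down positions independently.\<close>

lemma sum_choose_occupation:
  assumes "2 * M \<le> N"
  shows "(\<Sum>p\<le>M. (L choose (N - 2 * p)) * ((L - (N - 2 * p)) choose p) * ((N - 2 * p) choose (M - p)))
    = (L choose (N - M)) * (L choose M)"
proof -
  have "(L choose (N - 2 * p)) * ((L - (N - 2 * p)) choose p) * ((N - 2 * p) choose (M - p))
     = (L choose M) * ((M choose p) * ((L - M) choose (N - M - p)))" if p: "p \<le> M" for p
  proof -
    \<comment> \<open>\<open>u\<close> counts the singly occupied sites, \<open>v\<close> the down
      spins among them, and \<open>u - v\<close> the sites with only an up spin. The choices are
      reordered: all \<open>M\<close> down positions, the \<open>p\<close> doubly occupied ones
      among them, then the sites with only an up spin.\<close>
    define u v where "u = N - 2 * p" and "v = M - p"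
    have uv: "v \<le> u" "u - v = N - M - p" "v \<le> M" "M - v = p" using p assms by (auto simp: u_def v_def)
    have "(L choose u) * ((L - u) choose p) * (u choose v) = ((L choose u) * (u choose v)) * ((L - u) choose p)"
      by simp
    also have "\<dots> = (L choose v) * (((L - v) choose (u - v)) * ((L - u) choose p))"
      using choose_choose[OF uv(1), of L] by simp
    also have "\<dots> = (L choose v) * (((L - v) choose (u - v)) * ((L - v - (u - v)) choose p))"
      using uv(1) by simp
    also have "\<dots> = (L choose v) * (((L - v) choose p) * ((L - v - p) choose (u - v)))"
      by (simp only: choose_choose_commute)
    also have "\<dots> = ((L choose M) * (M choose v)) * ((L - M) choose (u - v))"
      using choose_choose[OF uv(3), of L] p by (simp add: uv(4) v_def)
    also have "M choose v = M choose p" using uv(4) binomial_symmetric[OF uv(3)] by simp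
    finally show ?thesis by (simp only: u_def[symmetric] v_def[symmetric] uv(2)[symmetric] mult.assoc)
  qed
  then have "(\<Sum>p\<le>M. (L choose (N - 2 * p)) * ((L - (N - 2 * p)) choose p) * ((N - 2 * p) choose (M - p)))
    = (L choose M) * (\<Sum>p\<le>M. (M choose p) * ((L - M) choose (N - M - p)))"
    by (simp add: sum_distrib_left)
  also have "(\<Sum>p\<le>M. (M choose p) * ((L - M) choose (N - M - p))) = (\<Sum>p\<le>N - M. (M choose p) * ((L - M) choose (N - M - p)))"
    using assms by (intro sum.mono_neutral_left) auto
  also have "\<dots> = (M + (L - M)) choose (N - M)"
    by (rule vandermonde)
  \<comment> \<open>\<open>M + (L - M)\<close> collapses to \<open>L\<close> only for
    \<open>M \<le> L\<close>; otherwise the factor \<open>L choose M\<close> is zero on both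
    sides.\<close>
  finally show ?thesis by (cases "M \<le> L") auto
qed

lemma sum_supp_Un:
  fixes f g :: "nat \<Rightarrow> nat"
  assumes "finite (supp f)" "finite (supp g)"
  shows "(\<Sum>n\<in>supp f \<union> supp g. n * (f n + g n)) = (\<Sum>n\<in>supp f. n * f n) + (\<Sum>n\<in>supp g. n * g n)"
proof -
  have "(\<Sum>n\<in>supp f. n * f n) = (\<Sum>n\<in>supp f \<union> supp g. n * f n)"
    using assms by (intro sum.mono_neutral_left) (auto simp: supp_def)
  moreover have "(\<Sum>n\<in>supp g. n * g n) = (\<Sum>n\<in>supp f \<union> supp g. n * g n)"
    using assms by (intro sum.mono_neutral_left) (auto simp: supp_def)
  ultimately show ?thesis by (simp add: distrib_left sum.distrib)
qed

lemma prod_supp_Un: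
  fixes x y :: "nat \<Rightarrow> 'a :: comm_monoid_mult"
  assumes "finite (supp f)" "finite (supp g)" "\<And>n. g n = 0 \<Longrightarrow> x n = 1" "\<And>n. f n = 0 \<Longrightarrow> y n = 1"
  shows "(\<Prod>n\<in>supp f \<union> supp g. x n * y n) = (\<Prod>n\<in>supp g. x n) * (\<Prod>n\<in>supp f. y n)"
proof -
  have "(\<Prod>n\<in>supp f. y n) = (\<Prod>n\<in>supp f \<union> supp g. y n)"
    using assms by (intro prod.mono_neutral_left) (auto simp: supp_def)
  moreover have "(\<Prod>n\<in>supp g. x n) = (\<Prod>n\<in>supp f \<union> supp g. x n)"
    using assms by (intro prod.mono_neutral_left) (auto simp: supp_def)
  ultimately show ?thesis by (simp add: prod.distrib)
qed

lemma ibinom_of_nat: "ibinom (int n) k = of_nat (n choose k)"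
  by (simp add: ibinom_def binomial_gbinomial)

lemma Ztilde_term:
  assumes "finite (supp f)" "finite (supp g)"
  shows "(\<Prod>n\<in>supp f \<union> supp g.
         ibinom (Pp L N g n + int (g n) + int n) (g n) * ibinom (Pn N M f n + int (f n)) (f n))
    = weight (of_int (int L - int N)) 1 g * weight (of_int (int N - 2 * int M)) 0 f"
proof -
  have "(\<Prod>n\<in>supp f \<union> supp g.
         ibinom (Pp L N g n + int (g n) + int n) (g n) * ibinom (Pn N M f n + int (f n)) (f n))
     = (\<Prod>n\<in>supp g. ibinom (Pp L N g n + int (g n) + int n) (g n)) * (\<Prod>n\<in>supp f. ibinom (Pn N M f n + int (f n)) (f n))"
    using assms by (intro prod_supp_Un) (auto simp: ibinom_def)
  moreover have "(\<Prod>n\<in>supp g. ibinom (Pp L N g n + int (g n) + int n) (g n)) = weight (of_int (int L - int N)) 1 g"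
    unfolding weight_def by (rule prod.cong) (auto simp: ibinom_def Pp_def algebra_simps)
  moreover have "(\<Prod>n\<in>supp f. ibinom (Pn N M f n + int (f n)) (f n)) = weight (of_int (int N - 2 * int M)) 0 f"
    unfolding weight_def by (rule prod.cong) (auto simp: ibinom_def Pn_def algebra_simps)
  ultimately show ?thesis by simp
qed

text \<open>Here \<open>p\<close> is the number of doubly occupied sites: the \<open>M'\<close> sum
  gives the choices of their positions, the \<open>M\<close> sum a ballot number for the spins on
  the \<open>N - 2p\<close> singly occupied sites. The two terms of the ballot number are summed by
  \<open>sum_choose_occupation\<close>, for \<open>M\<close> and for \<open>M - 1\<close>.\<close>

lemma Ztilde_eq:
  assumes MN: "2 * M \<le> N"
  shows "Ztilde L N M = of_nat ((L choose (N - M)) * (L choose M)) 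
     - (if M = 0 then 0 else of_nat ((L choose (N - M + 1)) * (L choose (M - 1))))"
proof -
  let ?D = "SIGMA p:{..M}. families (M - p) \<times> families p"
  let ?w0 = "weight (of_nat (N - 2 * M)) 0" and ?w1 = "weight (of_int (int L - int N)) 1"
  have "Ztilde L N M = (\<Sum>(p, f, g)\<in>?D. of_nat (L choose (N - 2 * p)) * (?w1 g * ?w0 f))"
    unfolding Ztilde_def
  \<comment> \<open>\<open>Nr\<close> and \<open>p\<close> determine each other by
    \<open>Nr = N - 2p\<close>; this is a genuine subtraction since \<open>p \<le> M\<close> and
    \<open>2M \<le> N\<close>.\<close>
  proof (rule sum.reindex_bij_witness[of _ "\<lambda>(p, f, g). (N - 2 * p, f, g)" "\<lambda>(Nr, f, g). ((\<Sum>n\<in>supp g. n * g n), f, g)"])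
    fix z assume "z \<in> Zidx N M"
    then obtain Nr f g where z: "z = (Nr, f, g)" and fg: "f 0 = 0" "g 0 = 0" "finite (supp f)" "finite (supp g)"
      "N = Nr + 2 * (\<Sum>n\<in>supp g. n * g n)" "M = (\<Sum>n\<in>supp f \<union> supp g. n * (f n + g n))"
      by (auto simp: Zidx_def)
    have M: "M = (\<Sum>n\<in>supp f. n * f n) + (\<Sum>n\<in>supp g. n * g n)"
      using fg by (simp add: sum_supp_Un)
    show "(case case z of (Nr, f, g) \<Rightarrow> ((\<Sum>n\<in>supp g. n * g n), f, g) of (p, f, g) \<Rightarrow> (N - 2 * p, f, g)) = z"
      using fg(5) by (simp add: z)
    show "(case z of (Nr, f, g) \<Rightarrow> ((\<Sum>n\<in>supp g. n * g n), f, g)) \<in> ?D"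
      using fg M by (simp add: z families_def)
    have "int N - 2 * int M = int (N - 2 * M)" using MN by simp
    then show "(case case z of (Nr, f, g) \<Rightarrow> ((\<Sum>n\<in>supp g. n * g n), f, g) of (p, f, g) \<Rightarrow>
        of_nat (L choose (N - 2 * p)) * (?w1 g * ?w0 f)) =
      (case z of (Nr, Mf, Mf') \<Rightarrow> ibinom (int L) Nr *
      (\<Prod>n\<in>supp Mf \<union> supp Mf'.
         ibinom (Pp L N Mf' n + int (Mf' n) + int n) (Mf' n) *
         ibinom (Pn N M Mf n + int (Mf n)) (Mf n)))"
      using fg(5) by (simp add: z Ztilde_term[OF fg(3,4)] ibinom_of_nat)
  next
    fix d assume "d \<in> ?D"
    then obtain p f g where d: "d = (p, f, g)" and p: "p \<le> M" and fg: "f \<in> families (M - p)" "g \<in> families p"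
      by auto
    show "(case case d of (p, f, g) \<Rightarrow> (N - 2 * p, f, g) of (Nr, f, g) \<Rightarrow> ((\<Sum>n\<in>supp g. n * g n), f, g)) = d"
      using fg by (simp add: d families_def)
    show "(case d of (p, f, g) \<Rightarrow> (N - 2 * p, f, g)) \<in> Zidx N M"
      using fg p MN by (simp add: d Zidx_def families_def sum_supp_Un)
  qed
  also have "\<dots> = (\<Sum>p\<le>M. \<Sum>(f, g)\<in>families (M - p) \<times> families p. of_nat (L choose (N - 2 * p)) * (?w1 g * ?w0 f))"
    by (subst sum.Sigma) (auto simp: finite_families intro!: sum.cong)
  also have "\<dots> = (\<Sum>p\<le>M. of_nat (L choose (N - 2 * p)) * ((\<Sum>g\<in>families p. ?w1 g) * (\<Sum>f\<in>families (M - p). ?w0 f)))"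
  proof (rule sum.cong)
    fix p
    have "(\<Sum>(f, g)\<in>families (M - p) \<times> families p. of_nat (L choose (N - 2 * p)) * (?w1 g * ?w0 f)) =
       (\<Sum>f\<in>families (M - p). \<Sum>g\<in>families p. of_nat (L choose (N - 2 * p)) * (?w1 g * ?w0 f))"
      by (rule sum.cartesian_product[symmetric])
    also have "\<dots> = of_nat (L choose (N - 2 * p)) * ((\<Sum>g\<in>families p. ?w1 g) * (\<Sum>f\<in>families (M - p). ?w0 f))"
      by (simp add: sum_distrib_left sum_distrib_right)
    finally show "(\<Sum>(f, g)\<in>families (M - p) \<times> families p. of_nat (L choose (N - 2 * p)) * (?w1 g * ?w0 f)) = \<dots>" .
  qed simp
  also have "\<dots> = (\<Sum>p\<le>M. of_nat ((L choose (N - 2 * p)) * ((L - (N - 2 * p)) choose p) * ((N - 2 * p) choose (M - p)))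
     - (if p = M then 0 else of_nat ((L choose (N - 2 * p)) * ((L - (N - 2 * p)) choose p) * ((N - 2 * p) choose (M - 1 - p)))))"
  proof (rule sum.cong)
    fix p assume "p \<in> {..M}"
    then have p: "p \<le> M" by simp
    have w0: "(\<Sum>f\<in>families (M - p). ?w0 f) = of_nat ((N - 2 * p) choose (M - p)) - (if p = M then 0 else of_nat ((N - 2 * p) choose (M - 1 - p)))"
    proof -
      have "N - 2 * M + 2 * (M - p) = N - 2 * p" "M - p - 1 = M - 1 - p" using MN p by auto
      then show ?thesis using p by (simp add: sum_families_weight_0)
    qed
    show "of_nat (L choose (N - 2 * p)) * ((\<Sum>g\<in>families p. ?w1 g) * (\<Sum>f\<in>families (M - p). ?w0 f)) =
      of_nat ((L choose (N - 2 * p)) * ((L - (N - 2 * p)) choose p) * ((N - 2 * p) choose (M - p)))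
     - (if p = M then 0 else of_nat ((L choose (N - 2 * p)) * ((L - (N - 2 * p)) choose p) * ((N - 2 * p) choose (M - 1 - p))))"
    \<comment> \<open>In the first case \<open>L - N + 2p\<close> is a natural number and the
      generalized binomial is an ordinary one. In the other it is negative, but
      \<open>L choose (N - 2p)\<close> vanishes.\<close>
    proof (cases "N - 2 * p \<le> L")
      case True
      have "of_int (int L - int N) + 2 * of_nat p = (of_nat (L - (N - 2 * p)) :: rat)"
        using True p MN by (simp add: of_nat_diff)
      then have w1: "(\<Sum>g\<in>families p. ?w1 g) = of_nat ((L - (N - 2 * p)) choose p)"
        by (simp only: sum_families_weight_1 binomial_gbinomial)
      show ?thesis unfolding w0 w1 by (simp add: algebra_simps)
    qed (simp add: binomial_eq_0)
  qed simp
  also have "\<dots> = of_nat (\<Sum>p\<le>M. (L choose (N - 2 * p)) * ((L - (N - 2 * p)) choose p) * ((N - 2 * p) choose (M - p)))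
    - (\<Sum>p\<le>M. if p = M then 0 else of_nat ((L choose (N - 2 * p)) * ((L - (N - 2 * p)) choose p) * ((N - 2 * p) choose (M - 1 - p))))"
    by (simp only: sum_subtractf of_nat_sum)
  also have "(\<Sum>p\<le>M. if p = M then 0 else of_nat ((L choose (N - 2 * p)) * ((L - (N - 2 * p)) choose p) * ((N - 2 * p) choose (M - 1 - p))))
    = (if M = 0 then 0 else (of_nat ((L choose (N - M + 1)) * (L choose (M - 1))) :: rat))"
  proof (cases M)
    \<comment> \<open>The summand at \<open>p = M\<close> is zero, so what remains is the occupation
      sum for \<open>r = M - 1\<close> with the same \<open>N\<close>.\<close>
    case (Suc r)
    have "(\<Sum>p\<le>r. (L choose (N - 2 * p)) * ((L - (N - 2 * p)) choose p) * ((N - 2 * p) choose (r - p))) = (L choose (N - r)) * (L choose r)"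
      by (rule sum_choose_occupation) (use MN Suc in simp)
    moreover have "N - r = N - M + 1" using Suc MN by simp
    ultimately show ?thesis unfolding Suc by (simp flip: of_nat_mult of_nat_sum)
  qed simp
  finally show ?thesis by (simp only: sum_choose_occupation[OF MN])
qed

section \<open>Tensoring with the four-dimensional module\<close>

lemma mat_vec_index:
  assumes "A \<in> carrier_mat r c" "v \<in> carrier_vec c" "i < r"
  shows "(A *\<^sub>v v) $ i = (\<Sum>j<c. A $$ (i, j) * v $ j)"
  using assms by (simp add: scalar_prod_def atLeast0LessThan)

text \<open>The vector \<open>\<Sum>\<^sub>s a\<^sub>s \<otimes> e\<^sub>s\<close> in the index convention of \<^const>\<open>kron\<close>,
  where \<open>e\<^sub>0, \<dots>, e\<^sub>3\<close> is the standard basis of \<^const>\<open>Vbase\<close>.\<close>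

definition interleave :: "nat \<Rightarrow> (nat \<Rightarrow> complex vec) \<Rightarrow> complex vec" where
  "interleave d a = vec (d * 4) (\<lambda>i. a (i mod 4) $ (i div 4))"

lemma interleave_carrier [simp]: "interleave d a \<in> carrier_vec (d * 4)" "dim_vec (interleave d a) = d * 4"
  by (simp_all add: interleave_def)

lemma interleave_cong:
  assumes "\<And>s. s < 4 \<Longrightarrow> a s = b s"
  shows "interleave d a = interleave d b"
  unfolding interleave_def by (rule eq_vecI) (auto simp: assms)

lemma interleave_add:
  assumes "\<And>s. s < 4 \<Longrightarrow> a s \<in> carrier_vec d" "\<And>s. s < 4 \<Longrightarrow> b s \<in> carrier_vec d"
  shows "interleave d a + interleave d b = interleave d (\<lambda>s. a s + b s)"
proof (rule eq_vecI)
  fix i assume "i < dim_vec (interleave d (\<lambda>s. a s + b s))"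
  then have "i < d * 4" "i div 4 < d" by (auto simp: interleave_def)
  moreover have "b (i mod 4) \<in> carrier_vec d" by (rule assms) simp
  ultimately show "(interleave d a + interleave d b) $ i = interleave d (\<lambda>s. a s + b s) $ i"
    by (auto simp: interleave_def)
qed simp

lemma interleave_smult:
  assumes "\<And>s. s < 4 \<Longrightarrow> a s \<in> carrier_vec d"
  shows "c \<cdot>\<^sub>v interleave d a = interleave d (\<lambda>s. c \<cdot>\<^sub>v a s)"
proof (rule eq_vecI)
  fix i assume "i < dim_vec (interleave d (\<lambda>s. c \<cdot>\<^sub>v a s))"
  then have "i < d * 4" "i div 4 < d" by (auto simp: interleave_def)
  moreover have "a (i mod 4) \<in> carrier_vec d" by (rule assms) simp
  ultimately show "(c \<cdot>\<^sub>v interleave d a) $ i = interleave d (\<lambda>s. c \<cdot>\<^sub>v a s) $ i"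
    by (auto simp: interleave_def)
qed simp

lemma interleave_zero: "interleave d (\<lambda>_. 0\<^sub>v d) = 0\<^sub>v (d * 4)"
  by (rule eq_vecI) (auto simp: interleave_def)

lemma kron_carrier:
  "A \<in> carrier_mat r c \<Longrightarrow> B \<in> carrier_mat r' c' \<Longrightarrow> kron A B \<in> carrier_mat (r * r') (c * c')"
  by (auto simp: kron_def)

lemma sum_mult_4: "(\<Sum>j<d * 4. h j) = (\<Sum>j<d. \<Sum>t<4. h (j * 4 + t))" for h :: "nat \<Rightarrow> complex"
proof -
  have "(\<Sum>j<d * 4. h j) = (\<Sum>j<d. sum h {j * 4..<j * 4 + 4})" 
    by (rule sum.nat_group[symmetric])
  also have "\<dots> = (\<Sum>j<d. \<Sum>t<4. h (j * 4 + t))"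
  proof (rule sum.cong)
    fix j
    show "sum h {j * 4..<j * 4 + 4} = (\<Sum>t<4. h (j * 4 + t))"
      by (rule sum.reindex_bij_witness[of _ "\<lambda>t. j * 4 + t" "\<lambda>i. i - j * 4"]) auto
  qed simp
  finally show ?thesis .
qed

lemma tensor_action:
  assumes X: "X \<in> carrier_mat d d" and B: "B \<in> carrier_mat 4 4" 
    and a: "\<And>s. s < 4 \<Longrightarrow> a s \<in> carrier_vec d"
  shows "(kron X (1\<^sub>m 4) + kron (1\<^sub>m d) B) *\<^sub>v interleave d a
    = interleave d (\<lambda>s. X *\<^sub>v a s + vec d (\<lambda>j. \<Sum>t<4. B $$ (s, t) * a t $ j))"
proof (rule eq_vecI)
  fix i assume "i < dim_vec (interleave d (\<lambda>s. X *\<^sub>v a s + vec d (\<lambda>j. \<Sum>t<4. B $$ (s, t) * a t $ j)))"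
  then have i: "i < d * 4" by simp
  define p s where "p = i div 4" and "s = i mod 4"
  have p: "p < d" and s: "s < 4" using i by (auto simp: p_def s_def)
  have K: "kron X (1\<^sub>m 4) + kron (1\<^sub>m d) B \<in> carrier_mat (d * 4) (d * 4)"
    using X B by (intro add_carrier_mat kron_carrier) auto
  have ent: "(kron X (1\<^sub>m 4) + kron (1\<^sub>m d) B) $$ (i, j * 4 + t)
      = X $$ (p, j) * (if s = t then 1 else 0) + (if p = j then 1 else 0) * B $$ (s, t)" 
    if "j < d" "t < 4" for j t
    using that X B i s p by (auto simp: kron_def p_def[symmetric] s_def[symmetric] )
  have "((kron X (1\<^sub>m 4) + kron (1\<^sub>m d) B) *\<^sub>v interleave d a) $ i 
    = (\<Sum>j<d. \<Sum>t<4. (kron X (1\<^sub>m 4) + kron (1\<^sub>m d) B) $$ (i, j * 4 + t) * interleave d a $ (j * 4 + t))"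
    by (simp only: mat_vec_index[OF K _ i] interleave_carrier sum_mult_4)
  also have "\<dots> = (\<Sum>j<d. \<Sum>t<4. (X $$ (p, j) * (if s = t then 1 else 0) + (if p = j then 1 else 0) * B $$ (s, t)) * a t $ j)"
    by (intro sum.cong refl) (simp add: ent, simp add: interleave_def)
  also have "\<dots> = (\<Sum>j<d. (\<Sum>t<4. if s = t then X $$ (p, j) * a t $ j else 0)) + (\<Sum>j<d. if p = j then (\<Sum>t<4. B $$ (s, t) * a t $ j) else 0)"
  proof -
    have "(X $$ (p, j) * (if s = t then 1 else 0) + (if p = j then 1 else 0) * B $$ (s, t)) * a t $ j
      = (if s = t then X $$ (p, j) * a t $ j else 0) + (if p = j then B $$ (s, t) * a t $ j else 0)" for j t
      by (simp add: distrib_right)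
    moreover have "(\<Sum>t<4. if p = j then B $$ (s, t) * a t $ j else 0) = (if p = j then (\<Sum>t<4. B $$ (s, t) * a t $ j) else 0)" for j
      by simp
    ultimately show ?thesis by (simp only: sum.distrib)
  qed
  also have "\<dots> = (\<Sum>j<d. X $$ (p, j) * a s $ j) + (\<Sum>t<4. B $$ (s, t) * a t $ p)"
    using p s by (simp add: sum.delta)
  also have "\<dots> = interleave d (\<lambda>s. X *\<^sub>v a s + vec d (\<lambda>j. \<Sum>t<4. B $$ (s, t) * a t $ j)) $ i"
    using i p s by (simp add: interleave_def p_def[symmetric] s_def[symmetric] mat_vec_index[OF X a[OF s] p] del: index_mult_mat_vec)
  finally show "((kron X (1\<^sub>m 4) + kron (1\<^sub>m d) B) *\<^sub>v interleave d a) $ i = \<dots>" .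
next
  show "dim_vec ((kron X (1\<^sub>m 4) + kron (1\<^sub>m d) B) *\<^sub>v interleave d a) =
    dim_vec (interleave d (\<lambda>s. X *\<^sub>v a s + vec d (\<lambda>j. \<Sum>t<4. B $$ (s, t) * a t $ j)))"
    using B by (simp add: kron_def)
qed

text \<open>The four matrices of \<open>Vbase\<close> in the basis empty, up, down, doubly occupied:
  \<open>Hub\<close> counts particles, and only the two middle states are linked by
  \<open>Eb\<close> and \<open>Fb\<close>.\<close>

definition Hub :: "complex mat" where
  "Hub = mat 4 4 (\<lambda>(i, j). if i = j then [0, 1, 1, 2] ! i else 0)"
definition Hsb :: "complex mat" where
  "Hsb = mat 4 4 (\<lambda>(i, j). if i = j then [0, 1, -1, 0] ! i else 0)"
definition Eb :: "complex mat" where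
  "Eb = mat 4 4 (\<lambda>(i, j). if i = 1 \<and> j = 2 then 1 else 0)"
definition Fb :: "complex mat" where
  "Fb = mat 4 4 (\<lambda>(i, j). if i = 2 \<and> j = 1 then 1 else 0)"

lemma less_4_cases: "(i::nat) < 4 \<Longrightarrow> i = 0 \<or> i = 1 \<or> i = 2 \<or> i = 3"
  by auto

lemma Vbase_eq: "Vbase = (Hub, Hsb, Eb, Fb)"
proof -
  have *: "A = B" if "A \<in> carrier_mat 4 4" "B \<in> carrier_mat 4 4" 
     "\<And>i j. i \<in> {0,1,2,3} \<Longrightarrow> j \<in> {0,1,2,3} \<Longrightarrow> A $$ (i, j) = B $$ (i, j)" for A B :: "complex mat"
    by (rule eq_matI) (use that less_4_cases in auto)
  show ?thesis
    unfolding Vbase_def dsum_list_def Virr_def zero_rep_def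
    by (simp add: dsum_def bdiag_def, intro conjI; rule *)
       (auto simp: four_block_mat_def Let_def Hub_def Hsb_def Eb_def Fb_def numeral_eq_Suc)
qed

definition quad :: "'a \<Rightarrow> 'a \<Rightarrow> 'a \<Rightarrow> 'a \<Rightarrow> nat \<Rightarrow> 'a" where
  "quad a b c e s = (if s = 0 then a else if s = 1 then b else if s = 2 then c else e)"

abbreviation tv :: "nat \<Rightarrow> complex vec \<Rightarrow> complex vec \<Rightarrow> complex vec \<Rightarrow> complex vec \<Rightarrow> complex vec" where
  "tv d a b c e \<equiv> interleave d (quad a b c e)"

lemma quad_simps [simp]:
  "quad a b c e 0 = a" "quad a b c e 1 = b" "quad a b c e (Suc 0) = b" "quad a b c e 2 = c" "quad a b c e 3 = e"
  by (simp_all add: quad_def)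

lemma tv_eq: "interleave d f = tv d (f 0) (f 1) (f 2) (f 3)"
proof (rule interleave_cong)
  fix s :: nat assume "s < 4"
  from less_4_cases[OF this] show "f s = quad (f 0) (f 1) (f 2) (f 3) s" by (elim disjE) simp_all
qed

lemma tv_add:
  assumes "a \<in> carrier_vec d" "b \<in> carrier_vec d" "c \<in> carrier_vec d" "e \<in> carrier_vec d"
    "a' \<in> carrier_vec d" "b' \<in> carrier_vec d" "c' \<in> carrier_vec d" "e' \<in> carrier_vec d"
  shows "tv d a b c e + tv d a' b' c' e' = tv d (a + a') (b + b') (c + c') (e + e')"
proof -
  have "quad a b c e s \<in> carrier_vec d" "quad a' b' c' e' s \<in> carrier_vec d" for s
    using assms by (simp_all add: quad_def)
  moreover have "(\<lambda>s. quad a b c e s + quad a' b' c' e' s) = quad (a + a') (b + b') (c + c') (e + e')"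
    by (rule ext) (simp add: quad_def)
  ultimately show ?thesis by (simp add: interleave_add)
qed

lemma tv_smult:
  assumes "a \<in> carrier_vec d" "b \<in> carrier_vec d" "c \<in> carrier_vec d" "e \<in> carrier_vec d"
  shows "k \<cdot>\<^sub>v tv d a b c e = tv d (k \<cdot>\<^sub>v a) (k \<cdot>\<^sub>v b) (k \<cdot>\<^sub>v c) (k \<cdot>\<^sub>v e)"
proof -
  have "quad a b c e s \<in> carrier_vec d" for s
    using assms by (simp add: quad_def)
  moreover have "(\<lambda>s. k \<cdot>\<^sub>v quad a b c e s) = quad (k \<cdot>\<^sub>v a) (k \<cdot>\<^sub>v b) (k \<cdot>\<^sub>v c) (k \<cdot>\<^sub>v e)"
    by (rule ext) (simp add: quad_def)
  ultimately show ?thesis by (simp add: interleave_smult)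
qed

lemma tensor_action_tv:
  assumes X: "X \<in> carrier_mat d d"
    and v: "a \<in> carrier_vec d" "b \<in> carrier_vec d" "c \<in> carrier_vec d" "e \<in> carrier_vec d"
  shows "(kron X (1\<^sub>m 4) + kron (1\<^sub>m d) Hub) *\<^sub>v tv d a b c e = tv d (X *\<^sub>v a) (X *\<^sub>v b + b) (X *\<^sub>v c + c) (X *\<^sub>v e + 2 \<cdot>\<^sub>v e)"
    "(kron X (1\<^sub>m 4) + kron (1\<^sub>m d) Hsb) *\<^sub>v tv d a b c e = tv d (X *\<^sub>v a) (X *\<^sub>v b + b) (X *\<^sub>v c - c) (X *\<^sub>v e)"
    "(kron X (1\<^sub>m 4) + kron (1\<^sub>m d) Eb) *\<^sub>v tv d a b c e = tv d (X *\<^sub>v a) (X *\<^sub>v b + c) (X *\<^sub>v c) (X *\<^sub>v e)"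
    "(kron X (1\<^sub>m 4) + kron (1\<^sub>m d) Fb) *\<^sub>v tv d a b c e = tv d (X *\<^sub>v a) (X *\<^sub>v b) (X *\<^sub>v c + b) (X *\<^sub>v e)"
proof -
  have q: "quad a b c e s \<in> carrier_vec d" for s using v by (simp add: quad_def)
  have s4: "(\<Sum>t<4. h t) = h 0 + h 1 + h 2 + h (3::nat)" for h :: "nat \<Rightarrow> complex"
    by (simp add: eval_nat_numeral)
  have gen: "(kron X (1\<^sub>m 4) + kron (1\<^sub>m d) B) *\<^sub>v tv d a b c e = 
     tv d (X *\<^sub>v a + h 0) (X *\<^sub>v b + h 1) (X *\<^sub>v c + h 2) (X *\<^sub>v e + h 3)" 
    if "B \<in> carrier_mat 4 4" "h = (\<lambda>s. vec d (\<lambda>j. B $$ (s, 0) * a $ j + B $$ (s, 1) * b $ j + B $$ (s, 2) * c $ j + B $$ (s, 3) * e $ j))" for B h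
    by (subst tensor_action[OF X that(1) q], subst tv_eq) (simp only: quad_simps s4 that(2))
  have Xc: "X *\<^sub>v w \<in> carrier_vec d" if "w \<in> carrier_vec d" for w using X that by simp
  have id: "vec d (\<lambda>j. w $ j) = w" "vec d (\<lambda>j. 2 * w $ j) = 2 \<cdot>\<^sub>v w" "X *\<^sub>v w + vec d (\<lambda>j. - w $ j) = X *\<^sub>v w - w"
    "X *\<^sub>v w + vec d (\<lambda>j. 0) = X *\<^sub>v w"
    if "w \<in> carrier_vec d" for w :: "complex vec" using that Xc[OF that] X by (auto intro!: eq_vecI)
  note ids = id[OF v(1)] id[OF v(2)] id[OF v(3)] id[OF v(4)]
  show "(kron X (1\<^sub>m 4) + kron (1\<^sub>m d) Hub) *\<^sub>v tv d a b c e = tv d (X *\<^sub>v a) (X *\<^sub>v b + b) (X *\<^sub>v c + c) (X *\<^sub>v e + 2 \<cdot>\<^sub>v e)"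
    by (subst gen[OF _ refl]) (simp_all add: Hub_def ids)
  show "(kron X (1\<^sub>m 4) + kron (1\<^sub>m d) Hsb) *\<^sub>v tv d a b c e = tv d (X *\<^sub>v a) (X *\<^sub>v b + b) (X *\<^sub>v c - c) (X *\<^sub>v e)"
    by (subst gen[OF _ refl]) (simp_all add: Hsb_def ids)
  show "(kron X (1\<^sub>m 4) + kron (1\<^sub>m d) Eb) *\<^sub>v tv d a b c e = tv d (X *\<^sub>v a) (X *\<^sub>v b + c) (X *\<^sub>v c) (X *\<^sub>v e)"
    by (subst gen[OF _ refl]) (simp_all add: Eb_def ids)
  show "(kron X (1\<^sub>m 4) + kron (1\<^sub>m d) Fb) *\<^sub>v tv d a b c e = tv d (X *\<^sub>v a) (X *\<^sub>v b) (X *\<^sub>v c + b) (X *\<^sub>v e)"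
    by (subst gen[OF _ refl]) (simp_all add: Fb_def ids)
qed

section \<open>Bases of highest weight strings\<close>

definition rep_carrier :: "nat \<Rightarrow> urep \<Rightarrow> bool" where
  "rep_carrier d V = (case V of (Hu, Hs, E, F) \<Rightarrow> Hu \<in> carrier_mat d d \<and> Hs \<in> carrier_mat d d \<and>
     E \<in> carrier_mat d d \<and> F \<in> carrier_mat d d)"

text \<open>The string is indexed by all naturals and is zero beyond \<open>m\<close>, so the rule
  for \<open>F\<close> needs no case for the last vector. At \<open>k = 0\<close> the coefficient
  for \<open>E\<close> is zero, which makes the truncated index \<open>k - 1\<close>
  harmless.\<close>

definition hw_string :: "nat \<Rightarrow> urep \<Rightarrow> nat \<Rightarrow> nat \<Rightarrow> (nat \<Rightarrow> complex vec) \<Rightarrow> bool" where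
  "hw_string d V N m w = (case V of (Hu, Hs, E, F) \<Rightarrow>
     (\<forall>k. w k \<in> carrier_vec d) \<and> (\<forall>k>m. w k = 0\<^sub>v d) \<and>
     (\<forall>k. Hu *\<^sub>v w k = of_nat N \<cdot>\<^sub>v w k) \<and>
     (\<forall>k. Hs *\<^sub>v w k = (of_nat m - 2 * of_nat k) \<cdot>\<^sub>v w k) \<and>
     (\<forall>k. E *\<^sub>v w k = (of_nat k * (of_nat m + 1 - of_nat k)) \<cdot>\<^sub>v w (k - 1)) \<and>
     (\<forall>k. F *\<^sub>v w k = w (Suc k)))"

definition lin_closed :: "nat \<Rightarrow> complex vec set \<Rightarrow> bool" where
  "lin_closed d U = (0\<^sub>v d \<in> U \<and> (\<forall>x\<in>U. \<forall>y\<in>U. x + y \<in> U) \<and> (\<forall>c. \<forall>x\<in>U. c \<cdot>\<^sub>v x \<in> U))"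

text \<open>Quantifying over subspaces makes it easy to transport spanning sets along linear maps.\<close>

definition spanning :: "nat \<Rightarrow> complex vec set \<Rightarrow> bool" where
  "spanning d A = (\<forall>U. lin_closed d U \<longrightarrow> A \<subseteq> U \<longrightarrow> carrier_vec d \<subseteq> U)"

text \<open>Linear independence is encoded by the count: the strings contribute \<open>d\<close>
  vectors in all, and these span a space of dimension \<open>d\<close>.\<close>

definition string_basis :: "nat \<Rightarrow> urep \<Rightarrow> (nat \<times> nat \<times> (nat \<Rightarrow> complex vec)) list \<Rightarrow> bool" where
  "string_basis d V S = (rep_carrier d V \<and> (\<forall>(N, m, w)\<in>set S. hw_string d V N m w) \<and>
     d = (\<Sum>(N, m, w)\<leftarrow>S. m + 1) \<and> spanning d (\<Union>(N, m, w)\<in>set S. range w))"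

lemma rdim_eq: "rep_carrier d V \<Longrightarrow> rdim V = d"
  by (auto simp: rep_carrier_def rdim_def)

lemma Vbase_mats [simp]: "Hub \<in> carrier_mat 4 4" "Hsb \<in> carrier_mat 4 4" "Eb \<in> carrier_mat 4 4" "Fb \<in> carrier_mat 4 4"
  by (simp_all add: Hub_def Hsb_def Eb_def Fb_def)

lemma tens_Vbase:
  assumes "rep_carrier d (Hu, Hs, E, F)"
  shows "tens (Hu, Hs, E, F) Vbase =
    (kron Hu (1\<^sub>m 4) + kron (1\<^sub>m d) Hub, kron Hs (1\<^sub>m 4) + kron (1\<^sub>m d) Hsb,
     kron E (1\<^sub>m 4) + kron (1\<^sub>m d) Eb, kron F (1\<^sub>m 4) + kron (1\<^sub>m d) Fb)"
proof -
  have "rdim Vbase = 4" by (simp add: Vbase_eq rdim_def Hub_def)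
  then show ?thesis using rdim_eq[OF assms] by (simp add: tens_def Vbase_eq Let_def)
qed

lemma rep_carrier_tens_Vbase:
  assumes "rep_carrier d V" shows "rep_carrier (d * 4) (tens V Vbase)"
proof -
  obtain Hu Hs E F where V: "V = (Hu, Hs, E, F)" by (cases V) auto
  show ?thesis using assms unfolding V tens_Vbase[OF assms[unfolded V]]
    by (auto simp: rep_carrier_def intro!: add_carrier_mat kron_carrier)
qed

text \<open>The last two are the strings through the highest weight vectors of
  \<open>V\<^sub>m \<otimes> V\<^sub>1 = V\<^bsub>m+1\<^esub> \<oplus> V\<^bsub>m-1\<^esub>\<close>.\<close>

lemma hw_string_tens:
  assumes V: "rep_carrier d V" and w: "hw_string d V N m w"
  shows hw_string_tens_0: "hw_string (d * 4) (tens V Vbase) N m (\<lambda>k. tv d (w k) (0\<^sub>v d) (0\<^sub>v d) (0\<^sub>v d))"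
    and hw_string_tens_2: "hw_string (d * 4) (tens V Vbase) (N + 2) m (\<lambda>k. tv d (0\<^sub>v d) (0\<^sub>v d) (0\<^sub>v d) (w k))"
    and hw_string_tens_up: "hw_string (d * 4) (tens V Vbase) (N + 1) (m + 1) 
        (\<lambda>k. tv d (0\<^sub>v d) (w k) (of_nat k \<cdot>\<^sub>v w (k - 1)) (0\<^sub>v d))"
    and hw_string_tens_down: "m \<ge> 1 \<Longrightarrow> hw_string (d * 4) (tens V Vbase) (N + 1) (m - 1) 
        (\<lambda>k. tv d (0\<^sub>v d) ((-1) \<cdot>\<^sub>v w (Suc k)) ((of_nat m - of_nat k) \<cdot>\<^sub>v w k) (0\<^sub>v d))"
proof -
  obtain Hu Hs E F where Veq: "V = (Hu, Hs, E, F)" by (cases V) auto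
  have mats: "Hu \<in> carrier_mat d d" "Hs \<in> carrier_mat d d" "E \<in> carrier_mat d d" "F \<in> carrier_mat d d"
    using V by (auto simp: rep_carrier_def Veq)
  have wc: "w k \<in> carrier_vec d" and w0: "k > m \<Longrightarrow> w k = 0\<^sub>v d" 
    and act: "Hu *\<^sub>v w k = of_nat N \<cdot>\<^sub>v w k" "Hs *\<^sub>v w k = (of_nat m - 2 * of_nat k) \<cdot>\<^sub>v w k"
     "E *\<^sub>v w k = (of_nat k * (of_nat m + 1 - of_nat k)) \<cdot>\<^sub>v w (k - 1)" "F *\<^sub>v w k = w (Suc k)" for k
    using w by (auto simp: hw_string_def Veq)
  have act': "Hu *\<^sub>v (c \<cdot>\<^sub>v w k) = c \<cdot>\<^sub>v (Hu *\<^sub>v w k)" "Hs *\<^sub>v (c \<cdot>\<^sub>v w k) = c \<cdot>\<^sub>v (Hs *\<^sub>v w k)"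
    "E *\<^sub>v (c \<cdot>\<^sub>v w k) = c \<cdot>\<^sub>v (E *\<^sub>v w k)" "F *\<^sub>v (c \<cdot>\<^sub>v w k) = c \<cdot>\<^sub>v (F *\<^sub>v w k)" for c k
    using mats wc by (auto simp: mult_mat_vec)
  have actz: "Hu *\<^sub>v 0\<^sub>v d = 0\<^sub>v d" "Hs *\<^sub>v 0\<^sub>v d = 0\<^sub>v d" "E *\<^sub>v 0\<^sub>v d = 0\<^sub>v d" "F *\<^sub>v 0\<^sub>v d = 0\<^sub>v d"
    using mats by (auto intro!: eq_vecI)
  have wd [simp]: "dim_vec (w k) = d" for k using wc[of k] by simp
  have z: "tv d (0\<^sub>v d) (0\<^sub>v d) (0\<^sub>v d) (0\<^sub>v d) = 0\<^sub>v (d * 4)"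
    using interleave_zero[of d] by (subst (asm) tv_eq) simp
  have sz [simp]: "c \<cdot>\<^sub>v 0\<^sub>v d = (0\<^sub>v d :: complex vec)" for c by (intro eq_vecI) auto
  have tv_cong: "tv d a b c e = tv d a' b' c' e'" if "a = a'" "b = b'" "c = c'" "e = e'" for a b c e a' b' c' e'
    using that by simp
  note T = tens_Vbase[OF V[unfolded Veq]]
  note A = tensor_action_tv[OF mats(1)] tensor_action_tv[OF mats(2)] tensor_action_tv[OF mats(3)] tensor_action_tv[OF mats(4)]
  note simps = A tv_smult wc act' actz act smult_smult_assoc
  show "hw_string (d * 4) (tens V Vbase) N m (\<lambda>k. tv d (w k) (0\<^sub>v d) (0\<^sub>v d) (0\<^sub>v d))"
    unfolding hw_string_def Veq T prod.case
    by (intro conjI allI impI) (simp_all add: simps w0 z)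
  show "hw_string (d * 4) (tens V Vbase) (N + 2) m (\<lambda>k. tv d (0\<^sub>v d) (0\<^sub>v d) (0\<^sub>v d) (w k))"
    unfolding hw_string_def Veq T prod.case
    by (intro conjI allI impI; (simp add: simps w0 z; fail)?) (simp add: simps, intro tv_cong eq_vecI; simp add: algebra_simps)
  \<comment> \<open>The \<open>k\<close>-th vector is \<open>F^k\<close> applied to
    \<open>w_0 (x) e_1\<close>. Since \<open>F\<close> maps \<open>e_1\<close> to \<open>e_2\<close>
    and kills \<open>e_2\<close>, the Leibniz rule gives the coefficient \<open>k\<close>.\<close>
  show "hw_string (d * 4) (tens V Vbase) (N + 1) (m + 1) 
        (\<lambda>k. tv d (0\<^sub>v d) (w k) (of_nat k \<cdot>\<^sub>v w (k - 1)) (0\<^sub>v d))"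
    unfolding hw_string_def Veq T prod.case
  proof (intro conjI allI impI, goal_cases)
    case (1 k) show ?case by simp
  next
    case (2 k) then show ?case by (simp add: w0 z)
  next
    case (3 k) show ?case
      by (simp add: simps, intro tv_cong eq_vecI; simp add: algebra_simps)
  next
    case (4 k) show ?case
      by (cases k) (simp_all add: simps, (intro tv_cong eq_vecI; simp add: algebra_simps)+)
  next
    case (5 k) show ?case
      by (cases k) (simp_all add: simps, (intro tv_cong eq_vecI; simp add: algebra_simps)+)
  next
    case (6 k) show ?case
      by (cases k) (simp_all add: simps, (intro tv_cong eq_vecI; simp add: algebra_simps)+)
  qed
  assume m: "m \<ge> 1"
  then have m1: "of_nat (m - 1) = (of_nat m - 1 :: complex)" by (simp add: of_nat_diff)
  \<comment> \<open>The string starts at \<open>m w_0 (x) e_2 - w_1 (x) e_1\<close>, which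
    \<open>E\<close> kills because \<open>E w_1 = m w_0\<close>. Each application of
    \<open>F\<close> lowers the coefficient of the \<open>e_2\<close> part by one.\<close>
  show "hw_string (d * 4) (tens V Vbase) (N + 1) (m - 1) 
        (\<lambda>k. tv d (0\<^sub>v d) ((-1) \<cdot>\<^sub>v w (Suc k)) ((of_nat m - of_nat k) \<cdot>\<^sub>v w k) (0\<^sub>v d))"
    unfolding hw_string_def Veq T prod.case m1
  proof (intro conjI allI impI, goal_cases)
    case (1 k) show ?case by simp
  next
    case (2 k) 
    \<comment> \<open>This string must end one step before \<open>w\<close> does: at
      \<open>k = m\<close> it is the scalar that vanishes, beyond that \<open>w k\<close>
      itself.\<close>
    then have "(of_nat m - of_nat k) \<cdot>\<^sub>v w k = 0\<^sub>v d" using m w0[of k] by (cases "k = m") (auto intro!: eq_vecI)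
    then show ?case using 2 by (simp add: w0 z)
  next
    case (3 k) show ?case
      by (simp add: simps, intro tv_cong eq_vecI; simp add: algebra_simps)
  next
    case (4 k) show ?case
      by (simp add: simps, intro tv_cong eq_vecI; simp add: algebra_simps)
  next
    case (5 k) show ?case
      by (cases k) (simp_all add: simps, (intro tv_cong eq_vecI; simp add: algebra_simps)+)
  next
    case (6 k) show ?case
      by (simp add: simps, intro tv_cong eq_vecI; simp add: algebra_simps)
  qed
qed

definition tens_strings where
  "tens_strings d t = (case t of (N :: nat, m :: nat, w) \<Rightarrow>
    [(N, m, \<lambda>k :: nat. tv d (w k) (0\<^sub>v d) (0\<^sub>v d) (0\<^sub>v d)),
     (N + 2, m, \<lambda>k. tv d (0\<^sub>v d) (0\<^sub>v d) (0\<^sub>v d) (w k)),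
     (N + 1, m + 1, \<lambda>k. tv d (0\<^sub>v d) (w k) (of_nat k \<cdot>\<^sub>v w (k - 1)) (0\<^sub>v d))] @
    (if m \<ge> 1 then [(N + 1, m - 1, \<lambda>k. tv d (0\<^sub>v d) ((-1) \<cdot>\<^sub>v w (Suc k)) ((of_nat m - of_nat k) \<cdot>\<^sub>v w k) (0\<^sub>v d))]
     else []))"

lemma lin_closed_vimage:
  assumes "lin_closed e U" "h (0\<^sub>v d) = 0\<^sub>v e" 
    "\<And>x y. x \<in> carrier_vec d \<Longrightarrow> y \<in> carrier_vec d \<Longrightarrow> h (x + y) = h x + h y"
    "\<And>c x. x \<in> carrier_vec d \<Longrightarrow> h (c \<cdot>\<^sub>v x) = c \<cdot>\<^sub>v h x"
  shows "lin_closed d {v \<in> carrier_vec d. h v \<in> U}"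
  using assms by (auto simp: lin_closed_def)

text \<open>The components along \<open>e_0\<close> and \<open>e_3\<close> come directly from the
  first two strings. Vector \<open>k + 1\<close> of the upper string plus vector \<open>k\<close> of
  the lower one is \<open>(m + 1) w_k (x) e_2\<close>, with \<open>m + 1\<close> invertible;
  subtracting multiples of these from the upper string isolates \<open>w_k (x) e_1\<close>.\<close>

lemma spanning_tens:
  assumes V: "string_basis d V S"
  shows "spanning (d * 4) (\<Union>(N, m, w)\<in>set (concat (map (tens_strings d) S)). range w)"
  unfolding spanning_def
proof (intro allI impI)
  fix U assume U: "lin_closed (d * 4) U" and sub: "(\<Union>(N, m, w)\<in>set (concat (map (tens_strings d) S)). range w) \<subseteq> U"
  have Uadd: "x + y \<in> U" if "x \<in> U" "y \<in> U" for x y using U that by (auto simp: lin_closed_def)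
  have Usm: "c \<cdot>\<^sub>v x \<in> U" if "x \<in> U" for c x using U that by (auto simp: lin_closed_def)
  have U0: "0\<^sub>v (d * 4) \<in> U" using U by (auto simp: lin_closed_def)
  have z: "tv d (0\<^sub>v d) (0\<^sub>v d) (0\<^sub>v d) (0\<^sub>v d) = 0\<^sub>v (d * 4)"
    using interleave_zero[of d] by (subst (asm) tv_eq) simp
  have sz [simp]: "c \<cdot>\<^sub>v 0\<^sub>v d = (0\<^sub>v d :: complex vec)" for c by (intro eq_vecI) auto
  have tv_cong: "tv d a b c e = tv d a' b' c' e'" if "a = a'" "b = b'" "c = c'" "e = e'" for a b c e a' b' c' e'
    using that by simp
  have span: "carrier_vec d \<subseteq> U'" if "lin_closed d U'" "\<And>N m w k. (N, m, w) \<in> set S \<Longrightarrow> w k \<in> U'" for U'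
  proof -
    have "(\<Union>(N, m, w)\<in>set S. range w) \<subseteq> U'" using that(2) by auto
    then show ?thesis using V that(1) by (auto simp: string_basis_def spanning_def)
  qed
  have str: "hw_string d V N m w" if "(N, m, w) \<in> set S" for N m w
    using V that by (auto simp: string_basis_def)
  have wc: "w k \<in> carrier_vec d" and w0: "k > m \<Longrightarrow> w k = 0\<^sub>v d" if "(N, m, w) \<in> set S" for N m w k
    using str[OF that] by (auto simp: hw_string_def)
  have mem: "w' k \<in> U" if "t \<in> set S" "(N', m', w') \<in> set (tens_strings d t)" for t N' m' w' k
    using sub that by fastforce
  \<comment> \<open>The preimage of \<open>U\<close> under a linear map \<open>h\<close> is closed
    under linear combinations, so it is everything as soon as it contains the strings of
    \<open>S\<close>. Below, \<open>h\<close> is each of the four embeddings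
    \<open>v \<mapsto> v (x) e_s\<close>.\<close>
  have emb: "carrier_vec d \<subseteq> {v \<in> carrier_vec d. h v \<in> U}"
    if "h (0\<^sub>v d) = 0\<^sub>v (d * 4)" 
    "\<And>x y. x \<in> carrier_vec d \<Longrightarrow> y \<in> carrier_vec d \<Longrightarrow> h (x + y) = h x + h y"
    "\<And>c x. x \<in> carrier_vec d \<Longrightarrow> h (c \<cdot>\<^sub>v x) = c \<cdot>\<^sub>v h x"
    "\<And>N m w k. (N, m, w) \<in> set S \<Longrightarrow> h (w k) \<in> U" for h
    by (rule span, rule lin_closed_vimage[OF U]) (use that wc in auto)
  have E0: "carrier_vec d \<subseteq> {v \<in> carrier_vec d. tv d v (0\<^sub>v d) (0\<^sub>v d) (0\<^sub>v d) \<in> U}"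
  proof (rule emb)
    fix N m w k assume "(N, m, w) \<in> set S"
    then show "tv d (w k) (0\<^sub>v d) (0\<^sub>v d) (0\<^sub>v d) \<in> U"
      by (rule mem[where k = k and N' = N and m' = m]) (simp add: tens_strings_def)
  qed (simp_all add: tv_add tv_smult z)
  have E3: "carrier_vec d \<subseteq> {v \<in> carrier_vec d. tv d (0\<^sub>v d) (0\<^sub>v d) (0\<^sub>v d) v \<in> U}"
  proof (rule emb)
    fix N m w k assume "(N, m, w) \<in> set S"
    then show "tv d (0\<^sub>v d) (0\<^sub>v d) (0\<^sub>v d) (w k) \<in> U"
      by (rule mem[where k = k and N' = "N + 2" and m' = m]) (simp add: tens_strings_def)
  qed (simp_all add: tv_add tv_smult z)
  have e2: "tv d (0\<^sub>v d) (0\<^sub>v d) (w k) (0\<^sub>v d) \<in> U" if S: "(N, m, w) \<in> set S" for N m w k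
  proof -
    have up: "tv d (0\<^sub>v d) (w (Suc k)) (of_nat (Suc k) \<cdot>\<^sub>v w k) (0\<^sub>v d) \<in> U"
      using mem[OF S, of "N + 1" "m + 1" "\<lambda>k. tv d (0\<^sub>v d) (w k) (of_nat k \<cdot>\<^sub>v w (k - 1)) (0\<^sub>v d)" "Suc k"] 
      by (simp add: tens_strings_def)
    have down: "tv d (0\<^sub>v d) ((-1) \<cdot>\<^sub>v w (Suc k)) ((of_nat m - of_nat k) \<cdot>\<^sub>v w k) (0\<^sub>v d) \<in> U"
    proof (cases "m \<ge> 1")
      case True
      show ?thesis
        by (rule mem[OF S, where k = k and N' = "N + 1" and m' = "m - 1"]) (use True in \<open>simp add: tens_strings_def\<close>)
    next
      case False
      \<comment> \<open>For \<open>m = 0\<close> there is no lower string, but its formula then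
        gives the zero vector for every \<open>k\<close>, which lies in \<open>U\<close>
        anyway.\<close>
      then have "(of_nat m - of_nat k) \<cdot>\<^sub>v w k = 0\<^sub>v d" using wc[OF S, of k] w0[OF S, of k] by (cases "k = 0") (auto intro!: eq_vecI)
      moreover have "w (Suc k) = 0\<^sub>v d" using False w0[OF S, of "Suc k"] by simp
      ultimately show ?thesis using U0 by (simp add: z)
    qed
    have "(of_nat m + 1 :: complex) \<noteq> 0" by (metis of_nat_Suc of_nat_neq_0 add.commute)
    then have "inverse (of_nat m + 1) \<cdot>\<^sub>v (tv d (0\<^sub>v d) (w (Suc k)) (of_nat (Suc k) \<cdot>\<^sub>v w k) (0\<^sub>v d) +
       tv d (0\<^sub>v d) ((-1) \<cdot>\<^sub>v w (Suc k)) ((of_nat m - of_nat k) \<cdot>\<^sub>v w k) (0\<^sub>v d)) = tv d (0\<^sub>v d) (0\<^sub>v d) (w k) (0\<^sub>v d)"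
      using wc[OF S, of k] wc[OF S, of "Suc k"]
      by (simp add: tv_add tv_smult wc[OF S], intro tv_cong eq_vecI; simp add: field_simps)
    then show ?thesis using Usm[OF Uadd[OF up down]] by metis
  qed
  have E2: "carrier_vec d \<subseteq> {v \<in> carrier_vec d. tv d (0\<^sub>v d) (0\<^sub>v d) v (0\<^sub>v d) \<in> U}"
    by (rule emb) (use e2 in \<open>auto simp add: tv_add tv_smult z\<close>)
  have E1: "carrier_vec d \<subseteq> {v \<in> carrier_vec d. tv d (0\<^sub>v d) v (0\<^sub>v d) (0\<^sub>v d) \<in> U}"
  proof (rule emb)
    fix N m w k assume S: "(N, m, w) \<in> set S"
    have up: "tv d (0\<^sub>v d) (w k) (of_nat k \<cdot>\<^sub>v w (k - 1)) (0\<^sub>v d) \<in> U"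
      by (rule mem[OF S, where k = k and N' = "N + 1" and m' = "m + 1"]) (simp add: tens_strings_def)
    have "tv d (0\<^sub>v d) (w k) (of_nat k \<cdot>\<^sub>v w (k - 1)) (0\<^sub>v d) + (- of_nat k) \<cdot>\<^sub>v tv d (0\<^sub>v d) (0\<^sub>v d) (w (k - 1)) (0\<^sub>v d)
      = tv d (0\<^sub>v d) (w k) (0\<^sub>v d) (0\<^sub>v d)"
      using wc[OF S, of k] wc[OF S, of "k - 1"]
      by (simp add: tv_add tv_smult wc[OF S], intro tv_cong eq_vecI; simp)
    then show "tv d (0\<^sub>v d) (w k) (0\<^sub>v d) (0\<^sub>v d) \<in> U"
      using Uadd[OF up Usm[OF e2[OF S, of "k - 1"]]] by metis
  qed (simp_all add: tv_add tv_smult z)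
  show "carrier_vec (d * 4) \<subseteq> U"
  proof
    fix u :: "complex vec" assume u: "u \<in> carrier_vec (d * 4)"
    define a where "a s = vec d (\<lambda>j. u $ (j * 4 + s))" for s
    have ac: "a s \<in> carrier_vec d" for s by (simp add: a_def)
    have "u = interleave d a"
      by (rule eq_vecI) (use u in \<open>auto simp: interleave_def a_def\<close>)
    also have "\<dots> = tv d (a 0) (a 1) (a 2) (a 3)" by (rule tv_eq)
    also have "\<dots> = tv d (a 0) (0\<^sub>v d) (0\<^sub>v d) (0\<^sub>v d) + tv d (0\<^sub>v d) (a 1) (0\<^sub>v d) (0\<^sub>v d) + tv d (0\<^sub>v d) (0\<^sub>v d) (a 2) (0\<^sub>v d) + tv d (0\<^sub>v d) (0\<^sub>v d) (0\<^sub>v d) (a 3)"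
      by (simp add: tv_add ac)
    also have "\<dots> \<in> U"
      using E0 E1 E2 E3 ac by (intro Uadd) blast+
    finally show "u \<in> U" .
  qed
qed

lemma string_basis_tens:
  assumes V: "string_basis d V S"
  shows "string_basis (d * 4) (tens V Vbase) (concat (map (tens_strings d) S))"
proof -
  have rc: "rep_carrier d V" and hw: "\<And>N m w. (N, m, w) \<in> set S \<Longrightarrow> hw_string d V N m w" and d: "d = (\<Sum>(N, m, w)\<leftarrow>S. m + 1)"
    using V by (auto simp: string_basis_def)
  \<comment> \<open>The lengths add up to \<open>2(m + 1) + (m + 2) + m = 4(m + 1)\<close>; for
    \<open>m = 0\<close> the missing fourth string would have length 0.\<close>
  have "(\<Sum>(N, m, w)\<leftarrow>concat (map (tens_strings e) T). m + 1) = (\<Sum>(N, m, w)\<leftarrow>T. m + 1) * 4" for e T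
    by (induction T) (auto simp: tens_strings_def)
  moreover have "hw_string (d * 4) (tens V Vbase) N' m' w'" 
    if "(N, m, w) \<in> set S" "(N', m', w') \<in> set (tens_strings d (N, m, w))" for N m w N' m' w'
    using that(2) hw_string_tens[OF rc hw[OF that(1)]] by (auto simp: tens_strings_def split: if_splits)
  ultimately show ?thesis
    unfolding string_basis_def
    using rep_carrier_tens_Vbase[OF rc] spanning_tens[OF V] d by auto
qed

lemma string_basis_one_rep: "string_basis 1 one_rep [(0, 0, \<lambda>k. if k = 0 then vec 1 (\<lambda>_. 1) else 0\<^sub>v 1)]"
proof -
  have z: "0\<^sub>m 1 1 *\<^sub>v v = 0\<^sub>v 1" if "v \<in> carrier_vec 1" for v :: "complex vec"
    using that by (intro eq_vecI) auto
  have sz: "c \<cdot>\<^sub>v 0\<^sub>v 1 = (0\<^sub>v 1 :: complex vec)" "0 \<cdot>\<^sub>v vec 1 f = (0\<^sub>v 1 :: complex vec)" for c f by (intro eq_vecI; auto)+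
  have "spanning 1 (range (\<lambda>k :: nat. if k = 0 then vec 1 (\<lambda>_. 1) else 0\<^sub>v 1))"
    unfolding spanning_def
  proof (intro allI impI subsetI)
    fix U and v :: "complex vec" 
    assume U: "lin_closed 1 U" "range (\<lambda>k :: nat. if k = 0 then vec 1 (\<lambda>_. 1) else 0\<^sub>v 1) \<subseteq> U" and v: "v \<in> carrier_vec 1"
    have "vec 1 (\<lambda>_. 1) \<in> U" using U(2) by force
    then have "v $ 0 \<cdot>\<^sub>v vec 1 (\<lambda>_. 1) \<in> U" using U(1) by (auto simp: lin_closed_def)
    moreover have "v $ 0 \<cdot>\<^sub>v vec 1 (\<lambda>_. 1) = v" using v by (intro eq_vecI) auto
    ultimately show "v \<in> U" by simp
  qed
  then show ?thesis
    by (auto simp: string_basis_def rep_carrier_def one_rep_def hw_string_def z sz)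
qed

text \<open>A string basis depends on the list only through its set and a sum, both unchanged by
  reordering. This lets the labels be sorted into the order in which the theorem lists its
  summands.\<close>

lemma string_basis_permute:
  assumes V: "string_basis d V S" and perm: "mset (map (\<lambda>(N, m, w). (N, m)) S) = mset ps"
  shows "\<exists>S'. string_basis d V S' \<and> map (\<lambda>(N, m, w). (N, m)) S' = ps"
proof -
  let ?f = "\<lambda>(N, m, w). (N, m)"
  have "list_all2 (\<lambda>x y. x = ?f y) (map ?f S) S"
    by (simp add: list_all2_map1 list_all2_refl)
  then obtain S' where S': "list_all2 (\<lambda>x y. x = ?f y) ps S'" "mset S' = mset S"
    using list_all2_reorder_left_invariance[OF _ perm[symmetric]] by auto
  have "map ?f S' = ps" using S'(1) by (induction rule: list_all2_induct) auto
  moreover have "set S' = set S" using S'(2) by (metis set_mset_mset)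
  moreover have "(\<Sum>(N, m, w)\<leftarrow>S'. m + 1) = (\<Sum>(N, m, w)\<leftarrow>S. m + 1)"
    using arg_cong[OF S'(2), of "\<lambda>A. \<Sum>\<^sub># (image_mset (\<lambda>(N, m, w). m + 1) A)"]
    by (simp only: mset_map[symmetric] sum_mset_sum_list)
  ultimately have "string_basis d V S' = string_basis d V S \<and> map ?f S' = ps" by (simp only: string_basis_def)
  then show ?thesis using V by blast
qed

section \<open>From string bases to isomorphisms with direct sums\<close>

text \<open>\<open>P\<close> maps \<open>W\<close> to \<open>V\<close>, opposite to the matrix in
  \<open>rep_iso\<close>: in this direction the strings are the columns of \<open>P\<close>, and
  summands of \<open>W\<close> are added by juxtaposing columns.\<close>

definition intertwines :: "nat \<Rightarrow> urep \<Rightarrow> nat \<Rightarrow> urep \<Rightarrow> complex mat \<Rightarrow> bool" where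
  "intertwines d V e W P = (case V of (Hu, Hs, E, F) \<Rightarrow> case W of (Hu', Hs', E', F') \<Rightarrow>
     P \<in> carrier_mat d e \<and> P * Hu' = Hu * P \<and> P * Hs' = Hs * P \<and> P * E' = E * P \<and> P * F' = F * P)"

text \<open>The columns of \<open>P\<close> are \<open>w 0, ..., w m\<close>; the relations of a
  string say exactly that \<open>P\<close> intertwines with the matrices of
  \<open>Virr\<close>.\<close>

lemma intertwines_string:
  assumes V: "rep_carrier d V" and w: "hw_string d V N m w"
  shows "\<exists>P. intertwines d V (m + 1) (Virr N m) P \<and> (\<forall>k. w k \<in> (\<lambda>v. P *\<^sub>v v) ` carrier_vec (m + 1))"
proof -
  obtain Hu Hs E F where Veq: "V = (Hu, Hs, E, F)" by (cases V) auto
  have mats: "Hu \<in> carrier_mat d d" "Hs \<in> carrier_mat d d" "E \<in> carrier_mat d d" "F \<in> carrier_mat d d"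
    using V by (auto simp: rep_carrier_def Veq)
  have wc: "w k \<in> carrier_vec d" and w0: "k > m \<Longrightarrow> w k = 0\<^sub>v d" 
    and act: "Hu *\<^sub>v w k = of_nat N \<cdot>\<^sub>v w k" "Hs *\<^sub>v w k = (of_nat m - 2 * of_nat k) \<cdot>\<^sub>v w k"
     "E *\<^sub>v w k = (of_nat k * (of_nat m + 1 - of_nat k)) \<cdot>\<^sub>v w (k - 1)" "F *\<^sub>v w k = w (Suc k)" for k
    using w by (auto simp: hw_string_def Veq)
  have wd [simp]: "dim_vec (w k) = d" for k using wc[of k] by simp
  define P where "P = mat d (m + 1) (\<lambda>(i, k). w k $ i)"
  have P: "P \<in> carrier_mat d (m + 1)" by (simp add: P_def)
  have colP: "col P k = w k" if "k < m + 1" for k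
    using that by (intro eq_vecI) (auto simp: P_def)
  have eq: "P * X = Y * P" 
    if "Y \<in> carrier_mat d d" "X = mat (m + 1) (m + 1) f" 
      "\<And>i j. i < d \<Longrightarrow> j < m + 1 \<Longrightarrow> (\<Sum>k<m + 1. w k $ i * f (k, j)) = (Y *\<^sub>v w j) $ i" for X Y f
  proof (rule eq_matI)
    fix i j assume "i < dim_row (Y * P)" "j < dim_col (Y * P)"
    then have ij: "i < d" "j < m + 1" using that P by auto
    have "(P * X) $$ (i, j) = (\<Sum>k<m + 1. w k $ i * f (k, j))"
      using ij that(2) by (simp add: P_def scalar_prod_def atLeast0LessThan)
    also have "\<dots> = (Y *\<^sub>v w j) $ i" by (rule that(3)[OF ij])
    also have "\<dots> = (Y * P) $$ (i, j)"
      using ij that(1) P colP[OF ij(2)] by simp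
    finally show "(P * X) $$ (i, j) = (Y * P) $$ (i, j)" .
  qed (use that P in auto)
  have "intertwines d V (m + 1) (Virr N m) P"
    unfolding intertwines_def Veq Virr_def prod.case
  proof (intro conjI P)
    show "P * mat (m + 1) (m + 1) (\<lambda>(i, j). if i = j then of_nat N else 0) = Hu * P"
      by (rule eq[OF mats(1) refl]) (simp add: act if_distrib[of "\<lambda>x. _ * x"] sum.delta mult.commute cong: if_cong)
    show "P * mat (m + 1) (m + 1) (\<lambda>(i, j). if i = j then of_int (int m - 2 * int i) else 0) = Hs * P"
      by (rule eq[OF mats(2) refl]) (simp add: act if_distrib[of "\<lambda>x. _ * x"] sum.delta mult.commute cong: if_cong)
    show "P * mat (m + 1) (m + 1) (\<lambda>(i, j). if i + 1 = j then of_nat (j * (m + 1 - j)) else 0) = E * P"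
    proof (rule eq[OF mats(3) refl])
      fix i j assume ij: "i < d" "j < m + 1"
      show "(\<Sum>k<m + 1. w k $ i * (case (k, j) of (i, j) \<Rightarrow> if i + 1 = j then of_nat (j * (m + 1 - j)) else 0)) = (E *\<^sub>v w j) $ i"
      proof (cases j)
        case 0
        then show ?thesis using ij by (simp add: act)
      next
        case (Suc r)
        have "(\<Sum>k<m + 1. w k $ i * (case (k, j) of (i, j) \<Rightarrow> if i + 1 = j then of_nat (j * (m + 1 - j)) else 0))
          = (\<Sum>k<m + 1. if k = r then w k $ i * of_nat (j * (m + 1 - j)) else 0)"
          by (rule sum.cong) (auto simp: Suc)
        also have "\<dots> = w r $ i * of_nat (j * (m + 1 - j))" using ij Suc by (simp add: sum.delta del: sum.lessThan_Suc)
        also have "of_nat (j * (m + 1 - j)) = (of_nat j * (of_nat m + 1 - of_nat j) :: complex)"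
          using ij by (simp add: of_nat_diff)
        also have "w r $ i * (of_nat j * (of_nat m + 1 - of_nat j)) = (E *\<^sub>v w j) $ i"
          using ij Suc by (simp add: act mult.commute del: index_mult_mat_vec)
        finally show ?thesis .
      qed
    qed
    show "P * mat (m + 1) (m + 1) (\<lambda>(i, j). if i = j + 1 then 1 else 0) = F * P"
    proof (rule eq[OF mats(4) refl])
      fix i j assume ij: "i < d" "j < m + 1"
      have "(\<Sum>k<m + 1. w k $ i * (case (k, j) of (i, j) \<Rightarrow> if i = j + 1 then 1 else 0))
        = (\<Sum>k<m + 1. if k = Suc j then w k $ i else 0)"
        by (rule sum.cong) auto
      \<comment> \<open>For \<open>j = m\<close> the sum has no index \<open>Suc j\<close> and is
        zero, in agreement with \<open>w (Suc m) = 0\<close>.\<close>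
      also have "\<dots> = w (Suc j) $ i" using ij w0[of "Suc j"] by (auto simp add: sum.delta simp del: sum.lessThan_Suc)
      finally show "(\<Sum>k<m + 1. w k $ i * (case (k, j) of (i, j) \<Rightarrow> if i = j + 1 then 1 else 0)) = (F *\<^sub>v w j) $ i"
        by (simp only: act)
    qed
  qed
  moreover have "w k \<in> (\<lambda>v. P *\<^sub>v v) ` carrier_vec (m + 1)" for k
  proof (cases "k < m + 1")
    case True
    have "P *\<^sub>v unit_vec (m + 1) k = col P k"
      using True P by (intro eq_vecI) (auto simp: scalar_prod_right_unit)
    then show ?thesis using colP[OF True] by (intro image_eqI[of _ _ "unit_vec (m + 1) k"]) auto
  next
    case False
    have "P *\<^sub>v 0\<^sub>v (m + 1) = 0\<^sub>v d" using P by (intro eq_vecI) auto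
    then show ?thesis using w0[of k] False by (intro image_eqI[of _ _ "0\<^sub>v (m + 1)"]) auto
  qed
  ultimately show ?thesis by blast
qed

lemma intertwines_dsum:
  assumes V: "rep_carrier d V" and W: "rep_carrier e1 W1" "rep_carrier e2 W2" 
    and P: "intertwines d V e1 W1 P1" "intertwines d V e2 W2 P2"
  shows "\<exists>P. intertwines d V (e1 + e2) (dsum W1 W2) P \<and>
    (\<forall>u\<in>carrier_vec e1. \<forall>v\<in>carrier_vec e2. P1 *\<^sub>v u + P2 *\<^sub>v v \<in> (\<lambda>v. P *\<^sub>v v) ` carrier_vec (e1 + e2))"
proof -
  obtain Hu Hs E F where Veq: "V = (Hu, Hs, E, F)" by (cases V) auto
  obtain Hu1 Hs1 E1 F1 where W1: "W1 = (Hu1, Hs1, E1, F1)" by (cases W1) auto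
  obtain Hu2 Hs2 E2 F2 where W2: "W2 = (Hu2, Hs2, E2, F2)" by (cases W2) auto
  \<comment> \<open>The block row \<open>(P1 P2)\<close>, completed by blocks without rows so that
    the product rule for 2 x 2 block matrices applies; \<open>Y\<close> is padded with empty blocks
    in the same way below.\<close>
  define P where "P = four_block_mat P1 P2 (0\<^sub>m 0 e1) (0\<^sub>m 0 e2)"
  have P1: "P1 \<in> carrier_mat d e1" and P2: "P2 \<in> carrier_mat d e2" 
    using P by (auto simp: intertwines_def Veq W1 W2)
  have Pc: "P \<in> carrier_mat d (e1 + e2)"
    unfolding P_def using four_block_carrier_mat[OF P1, of "0\<^sub>m 0 e2" 0 e2 P2 "0\<^sub>m 0 e1"] by simp
  have cong4: "four_block_mat A B C D = four_block_mat A' B' C' D'" if "A = A'" "B = B'" "C = C'" "D = D'"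
    for A B C D A' B' C' D' :: "complex mat" using that by simp
  have key: "P * bdiag A B = Y * P" if "P1 * A = Y * P1" "P2 * B = Y * P2" 
    "A \<in> carrier_mat e1 e1" "B \<in> carrier_mat e2 e2" "Y \<in> carrier_mat d d" for A B Y
  proof -
    have Y4: "Y = four_block_mat Y (0\<^sub>m d 0) (0\<^sub>m 0 d) (0\<^sub>m 0 0)" 
      by (rule eq_matI) (use that in auto)
    have "P * bdiag A B = four_block_mat (P1 * A + P2 * 0\<^sub>m e2 e1) (P1 * 0\<^sub>m e1 e2 + P2 * B) (0\<^sub>m 0 e1 * A + 0\<^sub>m 0 e2 * 0\<^sub>m e2 e1) (0\<^sub>m 0 e1 * 0\<^sub>m e1 e2 + 0\<^sub>m 0 e2 * B)"
      unfolding P_def bdiag_def using that 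
      by (subst mult_four_block_mat[OF P1 P2 _ _ that(3) _ _ that(4)]) auto
    also have "\<dots> = four_block_mat (Y * P1) (Y * P2) (0\<^sub>m 0 e1) (0\<^sub>m 0 e2)"
      using that P1 P2 by (intro cong4) auto
    also have "\<dots> = four_block_mat (Y * P1 + 0\<^sub>m d 0 * 0\<^sub>m 0 e1) (Y * P2 + 0\<^sub>m d 0 * 0\<^sub>m 0 e2) (0\<^sub>m 0 d * P1 + 0\<^sub>m 0 0 * 0\<^sub>m 0 e1) (0\<^sub>m 0 d * P2 + 0\<^sub>m 0 0 * 0\<^sub>m 0 e2)"
      using that P1 P2 by (intro cong4) auto
    also have "\<dots> = four_block_mat Y (0\<^sub>m d 0) (0\<^sub>m 0 d) (0\<^sub>m 0 0) * P"
      unfolding P_def by (rule mult_four_block_mat[OF that(5) _ _ _ P1 P2, symmetric]) auto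
    finally show ?thesis using Y4 by simp
  qed
  have "intertwines d V (e1 + e2) (dsum W1 W2) P"
    unfolding intertwines_def dsum_def Veq W1 W2 prod.case
    using V W P by (auto simp: Pc rep_carrier_def intertwines_def Veq W1 W2 intro!: key)
  moreover have "P1 *\<^sub>v u + P2 *\<^sub>v v \<in> (\<lambda>v. P *\<^sub>v v) ` carrier_vec (e1 + e2)" 
    if "u \<in> carrier_vec e1" "v \<in> carrier_vec e2" for u v
  proof (rule image_eqI)
    have "P *\<^sub>v (u @\<^sub>v v) = (P1 *\<^sub>v u + P2 *\<^sub>v v) @\<^sub>v (0\<^sub>m 0 e1 *\<^sub>v u + 0\<^sub>m 0 e2 *\<^sub>v v)"
      unfolding P_def by (rule four_block_mat_mult_vec[OF P1 P2 _ _ that]) auto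
    also have "\<dots> = P1 *\<^sub>v u + P2 *\<^sub>v v"
      using P1 P2 by (intro eq_vecI) auto
    finally show "P1 *\<^sub>v u + P2 *\<^sub>v v = P *\<^sub>v (u @\<^sub>v v)" ..
    show "u @\<^sub>v v \<in> carrier_vec (e1 + e2)" using that by simp
  qed
  ultimately show ?thesis by blast
qed

lemma rep_carrier_Virr: "rep_carrier (m + 1) (Virr N m)"
  by (simp add: rep_carrier_def Virr_def)

lemma rep_carrier_dsum: "rep_carrier e1 W1 \<Longrightarrow> rep_carrier e2 W2 \<Longrightarrow> rep_carrier (e1 + e2) (dsum W1 W2)"
  by (cases W1; cases W2) (auto simp: rep_carrier_def dsum_def bdiag_def)

lemma intertwines_dsum_list:
  assumes V: "rep_carrier d V" and S: "\<And>N m w. (N, m, w) \<in> set S \<Longrightarrow> hw_string d V N m w"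
  shows "rep_carrier (\<Sum>(N, m, w)\<leftarrow>S. m + 1) (dsum_list (map (\<lambda>(N, m, w). Virr N m) S)) \<and>
    (\<exists>P. intertwines d V (\<Sum>(N, m, w)\<leftarrow>S. m + 1) (dsum_list (map (\<lambda>(N, m, w). Virr N m) S)) P \<and>
      (\<forall>(N, m, w)\<in>set S. range w \<subseteq> (\<lambda>v. P *\<^sub>v v) ` carrier_vec (\<Sum>(N, m, w)\<leftarrow>S. m + 1)))"
  using S
proof (induction S)
  case Nil
  have "intertwines d V 0 zero_rep (0\<^sub>m d 0)"
    using V by (cases V) (auto simp: intertwines_def zero_rep_def rep_carrier_def)
  moreover have "rep_carrier 0 zero_rep" by (simp add: rep_carrier_def zero_rep_def)
  ultimately show ?case by (auto simp: dsum_list_def)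
next
  case (Cons t T)
  obtain N m w where t: "t = (N, m, w)" by (cases t) auto
  define e where "e = (\<Sum>(N, m, w)\<leftarrow>T. m + 1)"
  define W where "W = dsum_list (map (\<lambda>(N, m, w). Virr N m) T)"
  have "rep_carrier e W \<and> (\<exists>P. intertwines d V e W P \<and> (\<forall>(N, m, w)\<in>set T. range w \<subseteq> (\<lambda>v. P *\<^sub>v v) ` carrier_vec e))"
    unfolding e_def W_def by (rule Cons.IH) (use Cons.prems in auto)
  then obtain P2 where W: "rep_carrier e W" and P2: "intertwines d V e W P2" 
    and r2': "\<forall>(N, m, w)\<in>set T. range w \<subseteq> (\<lambda>v. P2 *\<^sub>v v) ` carrier_vec e"
    by (elim conjE exE)
  have r2: "w k \<in> (\<lambda>v. P2 *\<^sub>v v) ` carrier_vec e" if "(N, m, w) \<in> set T" for N m w k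
    using bspec[OF r2' that] by auto
  obtain P1 where P1: "intertwines d V (m + 1) (Virr N m) P1" and r1: "\<And>k. w k \<in> (\<lambda>v. P1 *\<^sub>v v) ` carrier_vec (m + 1)"
    using intertwines_string[OF V Cons.prems[of N m w]] t by auto
  obtain P where P: "intertwines d V (m + 1 + e) (dsum (Virr N m) W) P"
    and r: "\<And>u v. u \<in> carrier_vec (m + 1) \<Longrightarrow> v \<in> carrier_vec e \<Longrightarrow> P1 *\<^sub>v u + P2 *\<^sub>v v \<in> (\<lambda>v. P *\<^sub>v v) ` carrier_vec (m + 1 + e)"
    using intertwines_dsum[OF V rep_carrier_Virr W P1 P2] by blast
  have P1c: "P1 \<in> carrier_mat d (m + 1)" and P2c: "P2 \<in> carrier_mat d e"
    using P1 P2 by (auto simp: intertwines_def split: prod.splits)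
  have z1: "P1 *\<^sub>v 0\<^sub>v (m + 1) = 0\<^sub>v d" and z2: "P2 *\<^sub>v 0\<^sub>v e = 0\<^sub>v d"
    using P1c P2c by (auto intro!: eq_vecI)
  have "w k \<in> (\<lambda>v. P *\<^sub>v v) ` carrier_vec (m + 1 + e)" for k
  proof -
    obtain u where u: "u \<in> carrier_vec (m + 1)" "w k = P1 *\<^sub>v u" using r1[of k] by auto
    have "P1 *\<^sub>v u + 0\<^sub>v d = P1 *\<^sub>v u" using P1c u by (intro right_zero_vec mult_mat_vec_carrier)
    then show ?thesis using r[OF u(1), of "0\<^sub>v e"] by (simp add: z2 u(2))
  qed
  moreover have "w' k \<in> (\<lambda>v. P *\<^sub>v v) ` carrier_vec (m + 1 + e)" if T: "(N', m', w') \<in> set T" for N' m' w' k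
  proof -
    obtain u where u: "u \<in> carrier_vec e" "w' k = P2 *\<^sub>v u" using r2[OF T, of k] by auto
    have "0\<^sub>v d + P2 *\<^sub>v u = P2 *\<^sub>v u" using P2c u by (intro left_zero_vec mult_mat_vec_carrier)
    then show ?thesis using r[OF zero_carrier_vec u(1)] by (simp add: z1[simplified] u(2))
  qed
  moreover have "(\<Sum>(N, m, w)\<leftarrow>t # T. m + 1) = m + 1 + e" by (simp add: t e_def)
  moreover have "dsum_list (map (\<lambda>(N, m, w). Virr N m) (t # T)) = dsum (Virr N m) W"
    by (simp add: t W_def dsum_list_def)
  moreover have "rep_carrier (m + 1 + e) (dsum (Virr N m) W)"
    by (rule rep_carrier_dsum[OF rep_carrier_Virr W])
  ultimately show ?case using P by (simp only:) (intro conjI exI[of _ P]; auto simp only: t set_simps insert_iff)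
qed

text \<open>Preimages of the unit vectors form a right inverse \<open>Q\<close>, which is two-sided
  because the matrices are square. \<open>Q\<close> maps \<open>V\<close> to \<open>W\<close>, the
  direction that \<open>rep_iso\<close> asks for.\<close>

lemma rep_iso_if_surj_intertwiner:
  assumes V: "rep_carrier d V" and W: "rep_carrier d W" and P: "intertwines d V d W P"
    and surj: "carrier_vec d \<subseteq> (\<lambda>v. P *\<^sub>v v) ` carrier_vec d"
  shows "rep_iso V W"
proof -
  obtain Hu Hs E F where Veq: "V = (Hu, Hs, E, F)" by (cases V) auto
  obtain Hu' Hs' E' F' where Weq: "W = (Hu', Hs', E', F')" by (cases W) auto
  have Pc: "P \<in> carrier_mat d d" using P by (simp add: intertwines_def Veq Weq)
  have "\<exists>v\<in>carrier_vec d. P *\<^sub>v v = unit_vec d i" for i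
  proof -
    have "unit_vec d i \<in> (\<lambda>v. P *\<^sub>v v) ` carrier_vec d" using surj by auto
    then show ?thesis by (elim imageE) (auto intro!: bexI)
  qed
  then obtain q where q: "\<And>i. q i \<in> carrier_vec d" "\<And>i. P *\<^sub>v q i = unit_vec d i" by metis
  define Q where "Q = mat d d (\<lambda>(j, i). q i $ j)"
  have Qc: "Q \<in> carrier_mat d d" by (simp add: Q_def)
  have colQ: "col Q i = q i" if "i < d" for i
    by (rule eq_vecI) (use that q(1)[of i] in \<open>auto simp: Q_def\<close>)
  have PQ: "P * Q = 1\<^sub>m d"
  proof (rule eq_matI)
    fix i j assume "i < dim_row (1\<^sub>m d :: complex mat)" "j < dim_col (1\<^sub>m d :: complex mat)"
    then have ij: "i < d" "j < d" by auto
    then have "(P * Q) $$ (i, j) = (P *\<^sub>v q j) $ i" using Pc Qc colQ by simp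
    then show "(P * Q) $$ (i, j) = 1\<^sub>m d $$ (i, j)" using ij by (simp add: q(2) unit_vec_def)
  qed (use Pc Qc in auto)
  have QP: "Q * P = 1\<^sub>m d" by (rule mat_mult_left_right_inverse[OF Pc Qc PQ])
  have "invertible_mat Q"
    using Pc Qc PQ QP by (auto simp: invertible_mat_def inverts_mat_def)
  moreover have "Q * Y = X * Q" if "P * X = Y * P" "X \<in> carrier_mat d d" "Y \<in> carrier_mat d d" for X Y
  proof -
    have "Q * Y = Q * Y * (P * Q)" using that Qc by (simp add: PQ)
    also have "\<dots> = Q * (Y * P) * Q" using that Pc Qc by (simp add: assoc_mult_mat[of _ d d _ d _ d])
    also have "\<dots> = Q * P * X * Q" using that Pc Qc by (simp add: assoc_mult_mat[of _ d d _ d _ d] flip: that(1))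
    finally show ?thesis using that Qc by (simp add: QP)
  qed
  ultimately show ?thesis
    using V W P Qc rdim_eq[OF V] rdim_eq[OF W]
    unfolding rep_iso_def Veq Weq prod.case
    by (auto simp: rep_carrier_def intertwines_def intro!: bexI[of _ Q])
qed

text \<open>The image of the combined intertwiner is closed under linear combinations and contains
  all strings, hence is the whole space; the dimension count in \<open>string_basis\<close> makes
  the matrix square.\<close>

lemma rep_iso_string_basis:
  assumes "string_basis d V S"
  shows "rep_iso V (dsum_list (map (\<lambda>(N, m, w). Virr N m) S))"
proof -
  define W where "W = dsum_list (map (\<lambda>(N, m, w). Virr N m) S)"
  have V: "rep_carrier d V" and d: "d = (\<Sum>(N, m, w)\<leftarrow>S. m + 1)" and sp: "spanning d (\<Union>(N, m, w)\<in>set S. range w)"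
    and hw: "\<And>N m w. (N, m, w) \<in> set S \<Longrightarrow> hw_string d V N m w"
    using assms by (auto simp: string_basis_def)
  obtain P where W: "rep_carrier d W" and P: "intertwines d V d W P"
    and r: "\<forall>(N, m, w)\<in>set S. range w \<subseteq> (\<lambda>v. P *\<^sub>v v) ` carrier_vec d"
  proof -
    have "rep_carrier d W \<and> (\<exists>P. intertwines d V d W P \<and> (\<forall>(N, m, w)\<in>set S. range w \<subseteq> (\<lambda>v. P *\<^sub>v v) ` carrier_vec d))"
      using intertwines_dsum_list[OF V, of S, OF hw] by (simp only: W_def d[symmetric])
    then show ?thesis using that by (elim conjE exE)
  qed
  have Pc: "P \<in> carrier_mat d d" using P by (auto simp: intertwines_def split: prod.splits)
  have "lin_closed d ((\<lambda>v. P *\<^sub>v v) ` carrier_vec d)"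
    unfolding lin_closed_def
  proof (intro conjI ballI allI)
    show "0\<^sub>v d \<in> (\<lambda>v. P *\<^sub>v v) ` carrier_vec d"
      using Pc by (intro image_eqI[of _ _ "0\<^sub>v d"] eq_vecI) auto
  next
    fix x y assume "x \<in> (\<lambda>v. P *\<^sub>v v) ` carrier_vec d" "y \<in> (\<lambda>v. P *\<^sub>v v) ` carrier_vec d"
    then obtain a b where "a \<in> carrier_vec d" "b \<in> carrier_vec d" "x = P *\<^sub>v a" "y = P *\<^sub>v b" by auto
    then show "x + y \<in> (\<lambda>v. P *\<^sub>v v) ` carrier_vec d"
      using Pc by (intro image_eqI[of _ _ "a + b"]) (auto simp: mult_add_distrib_mat_vec)
  next
    fix c x assume "x \<in> (\<lambda>v. P *\<^sub>v v) ` carrier_vec d"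
    then obtain a where "a \<in> carrier_vec d" "x = P *\<^sub>v a" by auto
    then show "c \<cdot>\<^sub>v x \<in> (\<lambda>v. P *\<^sub>v v) ` carrier_vec d"
      using Pc by (intro image_eqI[of _ _ "c \<cdot>\<^sub>v a"]) (auto simp: mult_mat_vec)
  qed
  moreover have "(\<Union>(N, m, w)\<in>set S. range w) \<subseteq> (\<lambda>v. P *\<^sub>v v) ` carrier_vec d"
  proof
    fix x assume "x \<in> (\<Union>(N, m, w)\<in>set S. range w)"
    then obtain N m w where S: "(N, m, w) \<in> set S" and x: "x \<in> range w" by auto
    have "range w \<subseteq> (\<lambda>v. P *\<^sub>v v) ` carrier_vec d" using bspec[OF r S] by simp
    then show "x \<in> (\<lambda>v. P *\<^sub>v v) ` carrier_vec d" using x by blast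
  qed
  ultimately have "carrier_vec d \<subseteq> (\<lambda>v. P *\<^sub>v v) ` carrier_vec d"
    using sp by (auto simp: spanning_def)
  then show ?thesis using rep_iso_if_surj_intertwiner[OF V W P] by (simp add: W_def)
qed

section \<open>Multiplicities\<close>

definition tens_weights :: "nat \<times> nat \<Rightarrow> (nat \<times> nat) list" where
  "tens_weights t = (case t of (N, m) \<Rightarrow> [(N, m), (N + 2, m), (N + 1, m + 1)] @ (if m \<ge> 1 then [(N + 1, m - 1)] else []))"

primrec tpow_weights :: "nat \<Rightarrow> (nat \<times> nat) list" where
  "tpow_weights 0 = [(0, 0)]"
| "tpow_weights (Suc L) = concat (map tens_weights (tpow_weights L))"

lemma string_basis_tpow:
  "\<exists>d S. string_basis d (tpow Vbase L) S \<and> map (\<lambda>(N, m, w). (N, m)) S = tpow_weights L"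
proof (induction L)
  case 0
  show ?case using string_basis_one_rep
    by (intro exI[of _ 1] exI[of _ "[(0, 0, \<lambda>k. if k = 0 then vec 1 (\<lambda>_. 1) else 0\<^sub>v 1)]"]) simp
next
  case (Suc L)
  then obtain d S where S: "string_basis d (tpow Vbase L) S" "map (\<lambda>(N, m, w). (N, m)) S = tpow_weights L" by blast
  have "map (\<lambda>(N, m, w). (N, m)) (tens_strings d t) = tens_weights ((\<lambda>(N, m, w). (N, m)) t)" for t
    by (auto simp: tens_strings_def tens_weights_def split: prod.splits)
  then have "map (\<lambda>(N, m, w). (N, m)) (concat (map (tens_strings d) S)) = tpow_weights (Suc L)"
    by (simp add: map_concat comp_def flip: S(2))
  then show ?case using string_basis_tens[OF S(1)] by (intro exI[of _ "d * 4"] exI[of _ "concat (map (tens_strings d) S)"]) simp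
qed

text \<open>The recursion read backwards: the four terms are the labels from which
  \<open>(N, m)\<close> can arise. The guards exclude truncated subtraction.\<close>

lemma count_tens_weights:
  "count (mset (concat (map tens_weights xs))) (N, m) = count (mset xs) (N, m)
     + (if N \<ge> 2 then count (mset xs) (N - 2, m) else 0)
     + (if N \<ge> 1 \<and> m \<ge> 1 then count (mset xs) (N - 1, m - 1) else 0)
     + (if N \<ge> 1 then count (mset xs) (N - 1, m + 1) else 0)"
proof (induction xs)
  case (Cons x xs)
  obtain a b where x: "x = (a, b)" by (cases x)
  have e: "(a + 2, b) = (N, m) \<longleftrightarrow> N \<ge> 2 \<and> (a, b) = (N - 2, m)"
    "(a + 1, b + 1) = (N, m) \<longleftrightarrow> N \<ge> 1 \<and> m \<ge> 1 \<and> (a, b) = (N - 1, m - 1)"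
    "(b \<ge> 1 \<and> (a + 1, b - 1) = (N, m)) \<longleftrightarrow> N \<ge> 1 \<and> (a, b) = (N - 1, m + 1)"
    by auto
  have "count (mset (tens_weights (a, b))) (N, m) = (if (a, b) = (N, m) then 1 else 0)
     + (if (a + 2, b) = (N, m) then 1 else 0) + (if (a + 1, b + 1) = (N, m) then 1 else 0)
     + (if b \<ge> 1 \<and> (a + 1, b - 1) = (N, m) then 1 else 0)"
    by (auto simp: tens_weights_def)
  then have t: "count (mset (tens_weights (a, b))) (N, m) = (if (a, b) = (N, m) then 1 else 0)
     + (if N \<ge> 2 \<and> (a, b) = (N - 2, m) then 1 else 0)
     + (if N \<ge> 1 \<and> m \<ge> 1 \<and> (a, b) = (N - 1, m - 1) then 1 else 0)
     + (if N \<ge> 1 \<and> (a, b) = (N - 1, m + 1) then 1 else 0)"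
    by (simp only: e)
  have c: "count (mset (x # xs)) y = (if (a, b) = y then 1 else 0) + count (mset xs) y" for y
    by (simp add: x)
  have "count (mset (concat (map tens_weights (x # xs)))) (N, m)
     = count (mset (tens_weights (a, b))) (N, m) + count (mset (concat (map tens_weights xs))) (N, m)"
    by (simp add: x)
  then show ?case unfolding Cons.IH t c
    by (cases "N \<ge> 2"; cases "N \<ge> 1"; cases "m \<ge> 1") simp_all
qed simp

lemma tpow_weights_bounds:
  "(N, m) \<in> set (tpow_weights L) \<Longrightarrow> m \<le> N \<and> even (N - m) \<and> N \<le> 2 * L"
proof (induction L arbitrary: N m)
  case (Suc L)
  then obtain a b where ab: "(a, b) \<in> set (tpow_weights L)" "(N, m) \<in> set (tens_weights (a, b))" by auto
  have *: "b \<le> a \<and> even (a - b) \<and> a \<le> 2 * L" by (rule Suc.IH[OF ab(1)])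
  then obtain k where k: "a = b + 2 * k" by (metis dvdE le_add_diff_inverse)
  have "N = m + 2 * k \<or> N = m + 2 * (k + 1)" using ab(2) k by (auto simp: tens_weights_def split: if_splits)
  then show ?case using ab(2) * by (auto simp: tens_weights_def split: if_splits)
qed simp

lemma count_tpow_weights_0:
  "\<not> (m \<le> N \<and> even (N - m) \<and> N \<le> 2 * L) \<Longrightarrow> count (mset (tpow_weights L)) (N, m) = 0"
  using tpow_weights_bounds[of N m L] by (auto simp: count_eq_zero_iff)

text \<open>Applying Pascal's rule to both factors shows that each of the two products satisfies the
  four-term recursion. The missing term at \<open>m = 0\<close> is consistent because the
  difference, continued to \<open>m = -1\<close>, is zero: the two products become equal
  there.\<close>

lemma count_tpow_weights:
  "int (count (mset (tpow_weights L)) (m + 2 * k, m)) = 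
    int ((L choose (m + k)) * (L choose k)) - (if k = 0 then 0 else int ((L choose (m + k + 1)) * (L choose (k - 1))))"
proof (induction L arbitrary: m k)
  case 0
  show ?case by (cases k; cases m) auto
next
  case (Suc L)
  let ?c = "\<lambda>N m. int (count (mset (tpow_weights L)) (N, m))"
  have rec: "int (count (mset (tpow_weights (Suc L))) (m + 2 * k, m)) = ?c (m + 2 * k) m
     + (if m + 2 * k \<ge> 2 then ?c (m + 2 * k - 2) m else 0)
     + (if m \<ge> 1 then ?c (m + 2 * k - 1) (m - 1) else 0)
     + (if m + 2 * k \<ge> 1 then ?c (m + 2 * k - 1) (m + 1) else 0)"
    by (simp add: count_tens_weights)
  \<comment> \<open>For \<open>k = 0\<close> the labels \<open>(m - 2, m)\<close> and
    \<open>(m - 1, m + 1)\<close> have highest weight above the charge and do not occur.\<close>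
  have 1: "(if m + 2 * k \<ge> 2 then ?c (m + 2 * k - 2) m else 0) = (if k = 0 then 0 else ?c (m + 2 * (k - 1)) m)"
    using count_tpow_weights_0[of m "m - 2" L] by (cases k) auto
  have 2: "(if m \<ge> 1 then ?c (m + 2 * k - 1) (m - 1) else 0) = (if m = 0 then 0 else ?c ((m - 1) + 2 * k) (m - 1))"
    by (cases m) auto
  have 3: "(if m + 2 * k \<ge> 1 then ?c (m + 2 * k - 1) (m + 1) else 0) = (if k = 0 then 0 else ?c ((m + 1) + 2 * (k - 1)) (m + 1))"
    using count_tpow_weights_0[of "m + 1" "m - 1" L] by (cases k) auto
  show ?case unfolding rec 1 2 3 Suc.IH
    by (cases m; cases k) (simp_all add: algebra_simps, (cases "k - 1"; simp add: algebra_simps)+)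
qed

lemma count_concat: "count (mset (concat xss)) x = (\<Sum>xs\<leftarrow>xss. count (mset xs) x)"
  by (induction xss) auto

text \<open>By the size and parity bounds each occurring label is \<open>(N, N - 2M)\<close> for
  exactly one \<open>M \<le> N div 2\<close>, so grouping by \<open>N\<close> and \<open>M\<close>
  lists every label with its full multiplicity.\<close>

lemma mset_weights_by_multiplicity:
  "mset (concat (map (\<lambda>N. concat (map (\<lambda>M. replicate (count (mset (tpow_weights L)) (N, N - 2 * M)) (N, N - 2 * M))
      [0..<N div 2 + 1])) [0..<2 * L + 1])) = mset (tpow_weights L)"
proof (rule multiset_eqI)
  fix x :: "nat \<times> nat"
  obtain N m where x: "x = (N, m)" by (cases x)
  let ?c = "\<lambda>N m. count (mset (tpow_weights L)) (N, m)"
  have "count (mset (concat (map (\<lambda>N. concat (map (\<lambda>M. replicate (?c N (N - 2 * M)) (N, N - 2 * M))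
      [0..<N div 2 + 1])) [0..<2 * L + 1]))) x
    = (\<Sum>N'\<in>{0..<2 * L + 1}. \<Sum>M\<in>{0..<N' div 2 + 1}. if (N', N' - 2 * M) = (N, m) then ?c N' (N' - 2 * M) else 0)"
  proof -
    have "count (mset (replicate n y)) x = (if y = (N, m) then n else 0)" for n y by (simp add: x)
    then show ?thesis
      by (simp only: count_concat map_map comp_def interv_sum_list_conv_sum_set_nat set_upt)
  qed
  also have "\<dots> = (\<Sum>N'\<in>{0..<2 * L + 1}. if N' = N then (\<Sum>M\<in>{0..<N div 2 + 1}. if N - 2 * M = m then ?c N m else 0) else 0)"
    by (rule sum.cong) (auto intro!: sum.cong sum.neutral)
  also have "\<dots> = (if N \<le> 2 * L then (\<Sum>M\<in>{0..<N div 2 + 1}. if N - 2 * M = m then ?c N m else 0) else 0)"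
    by (simp add: sum.delta less_Suc_eq_le)
  also have "\<dots> = ?c N m"
  proof (cases "m \<le> N \<and> even (N - m) \<and> N \<le> 2 * L")
    case True
    then obtain k where k: "N = m + 2 * k" by (metis dvdE le_add_diff_inverse)
    have "(\<Sum>M\<in>{0..<N div 2 + 1}. if N - 2 * M = m then ?c N m else 0) = (\<Sum>M\<in>{0..<N div 2 + 1}. if M = k then ?c N m else 0)"
      by (rule sum.cong) (auto simp: k)
    also have "\<dots> = ?c N m" using k by (simp add: sum.delta)
    finally show ?thesis using True by simp
  next
    case False
    then have "?c N m = 0" by (rule count_tpow_weights_0)
    then show ?thesis by (simp only: if_cancel sum.neutral_const)
  qed
  finally show "count (mset (concat (map (\<lambda>N. concat (map (\<lambda>M. replicate (?c N (N - 2 * M)) (N, N - 2 * M))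
      [0..<N div 2 + 1])) [0..<2 * L + 1]))) x = count (mset (tpow_weights L)) x" by (simp add: x)
qed

theorem theorem2:
  fixes L :: nat
  assumes "L \<ge> 1"
  shows "\<exists>c :: nat \<Rightarrow> nat \<Rightarrow> nat.
           (\<forall>N \<le> 2 * L. \<forall>M \<le> N div 2. Ztilde L N M = of_nat (c N M)) \<and>
           rep_iso (tpow Vbase L)
             (dsum_list (concat (map (\<lambda>N. concat (map (\<lambda>M. replicate (c N M) (Virr N (N - 2 * M)))
                                                   [0..<N div 2 + 1]))
                                     [0..<2 * L + 1])))"
proof -
  \<comment> \<open>Taken from the module side, \<open>c\<close> is a natural number by
    construction; integrality of the rational \<open>Ztilde\<close> comes out of the
    comparison.\<close>
  define c where "c N M = count (mset (tpow_weights L)) (N, N - 2 * M)" for N M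
  define ps where "ps = concat (map (\<lambda>N. concat (map (\<lambda>M. replicate (c N M) (N, N - 2 * M)) [0..<N div 2 + 1])) [0..<2 * L + 1])"
  have "Ztilde L N M = of_nat (c N M)" if "M \<le> N div 2" for N M
  proof -
    have MN: "2 * M \<le> N" using that by simp
    define m where "m = N - 2 * M"
    have N: "N = m + 2 * M" "N - M = m + M" using MN by (auto simp: m_def)
    \<comment> \<open>The comparison passes through the integers, where the subtraction in the
      closed form is not truncated.\<close>
    have "(of_int (int (c N M)) :: rat) = of_int (int ((L choose (m + M)) * (L choose M)) - (if M = 0 then 0 else int ((L choose (m + M + 1)) * (L choose (M - 1)))))"
      using count_tpow_weights[of L m M] by (simp add: c_def flip: N(1) m_def)
    then show ?thesis unfolding Ztilde_eq[OF MN] N(2) by (cases "M = 0") simp_all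
  qed
  moreover have "rep_iso (tpow Vbase L) (dsum_list (map (\<lambda>(N, m). Virr N m) ps))"
  proof -
    obtain d S where S: "string_basis d (tpow Vbase L) S" "map (\<lambda>(N, m, w). (N, m)) S = tpow_weights L"
      using string_basis_tpow by blast
    have "mset (map (\<lambda>(N, m, w). (N, m)) S) = mset ps"
      by (simp only: S(2) ps_def c_def mset_weights_by_multiplicity)
    then obtain S' where S': "string_basis d (tpow Vbase L) S'" "map (\<lambda>(N, m, w). (N, m)) S' = ps"
      using string_basis_permute[OF S(1)] by blast
    have "map (\<lambda>(N, m, w). Virr N m) S' = map (\<lambda>(N, m). Virr N m) ps"
      by (auto simp flip: S'(2))
    then show ?thesis using rep_iso_string_basis[OF S'(1)] by (simp only:)
  qed
  moreover have "map (\<lambda>(N, m). Virr N m) ps = concat (map (\<lambda>N. concat (map (\<lambda>M. replicate (c N M) (Virr N (N - 2 * M))) [0..<N div 2 + 1])) [0..<2 * L + 1])"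
    by (simp add: ps_def map_concat comp_def)
  ultimately show ?thesis by (intro exI[of _ c]) simp
qed

end
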